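(* Let $V$ be the finite or countably infinite vertex set of a connected graph with bounded degree and more than one edge. Let $W$ be a finite subset of $V$, and suppose each element of $W$ has degree $1$. Then for $0\le t<1$, for dimer RSA, $$\frac{d}{dt}P[X_t^V(v)=0,\ v\in W]=-\sum_{v\in W}P\big[X_t^{V\setminus\{v\}}(w)=0,\ w\in (W\cup\mathcal N_1(v,V))\setminus\{v\}\big],$$ and for the annihilation process, $$\frac{d}{dt}P[X_t^V(v)=1,\ v\in W]=-\frac12\sum_{v\in W}P\big[X_t^{V\setminus\{v\}}(w)=1,\ w\in (W\cup\mathcal N_1(v,V))\setminus\{v\}\big].$$
   Context: Graphs have no loops or multiple edges; a subset of $V$ carries the induced subgraph structure. $\mathcal N_1(v,V)$ is the set of $w\in V$ at graph distance at most $1$ from $v$ in $V$. $P[X(v)=i,\ v\in A]$ is the probability that $X(v)=i$ for every $v\in A$. At $t=0$ the derivatives are right derivatives. Processes on a finite graph $V$ with edge set $E$; states are $1$ (occupied) and $0$ (vacant), and $X_t^V(v)$ is the state of $v$ at time $t$. The $\tau_e$, $e\in E$, are i.i.d. uniform on $(0,1)$. Dimer RSA: all sites are initially vacant; at time $\tau_e$, $e=\{u,v\}$, if $u$ and $v$ are both vacant then both become occupied; otherwise nothing changes. Occupied sites stay occupied forever. Annihilation process: all sites are initially occupied; at time $\tau_e$, $e=\{u,v\}$, if $u$ and $v$ are both occupied immediately before, then one of them, each with probability $1/2$ (chosen independently of everything else), becomes vacant; otherwise nothing changes. Vacant sites stay vacant forever. For countably infinite $V$ of bounded degree, $X_t^V(v):=\lim_n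 X_t^{V_n}(v)$, where $(V_n)$ is any sequence of finite subsets of $V$ with $\bigcup_n\bigcap_{m\ge n}V_m=V$ and the process on the induced subgraph $V_n$ uses the same $\tau_e$ and attack directions; almost surely this limit exists for all $v,t$ and does not depend on the sequence. *)

theory Defs
  imports "HOL-Probability.Probability"
begin

definition simple_graph :: "'a set \<Rightarrow> 'a set set \<Rightarrow> bool" where
  "simple_graph V E \<longleftrightarrow> (\<forall>e\<in>E. e \<subseteq> V \<and> card e = 2)"

definition induced_edges :: "'a set set \<Rightarrow> 'a set \<Rightarrow> 'a set set" where
  "induced_edges E A = {e \<in> E. e \<subseteq> A}"

definition adj :: "'a set \<Rightarrow> 'a set set \<Rightarrow> ('a \<times> 'a) set" where
  "adj V E = {(u, w). u \<in> V \<and> w \<in> V \<and> {u, w} \<in> E}"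

definition connected_graph :: "'a set \<Rightarrow> 'a set set \<Rightarrow> bool" where
  "connected_graph V E \<longleftrightarrow> (\<forall>u\<in>V. \<forall>w\<in>V. (u, w) \<in> (adj V E)\<^sup>*)"

definition vertex_degree :: "'a set set \<Rightarrow> 'a \<Rightarrow> nat" where
  "vertex_degree E v = card {e \<in> E. v \<in> e}"

(* Finiteness is required separately because card is 0 on infinite sets. *)
definition bounded_degree :: "'a set \<Rightarrow> 'a set set \<Rightarrow> bool" where
  "bounded_degree V E \<longleftrightarrow>
     (\<exists>D. \<forall>v\<in>V. finite {e \<in> E. v \<in> e} \<and> vertex_degree E v \<le> D)"

(* The ball of radius k around v: w is at distance at most k if and only if
   some walk with at most k edges joins v to w. *)
definition nbhd :: "nat \<Rightarrow> 'a \<Rightarrow> 'a set \<Rightarrow> 'a set set \<Rightarrow> 'a set" where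
  "nbhd k v V E = {w \<in> V. \<exists>n\<le>k. (v, w) \<in> adj V E ^^ n}"


(* Finite volume, for a fixed realisation T of the clocks (and d of the attack
   directions, d e being the endpoint of e that is vacated if e is effective).
   The clock values up to time t are processed in increasing order. Edges sharing
   a clock value, which almost surely do not exist, are treated simultaneously.
   States of sites outside A are never changed. *)

definition dimer_update ::
  "'a set set \<Rightarrow> ('a set \<Rightarrow> real) \<Rightarrow> real \<Rightarrow> ('a \<Rightarrow> nat) \<Rightarrow> 'a \<Rightarrow> nat" where
  "dimer_update F T s X v =
     (if \<exists>e\<in>F. T e = s \<and> v \<in> e \<and> (\<forall>u\<in>e. X u = 0) then 1 else X v)"

definition annih_update ::
  "'a set set \<Rightarrow> ('a set \<Rightarrow> real) \<Rightarrow> ('a set \<Rightarrow> 'a) \<Rightarrow> real \<Rightarrow> ('a \<Rightarrow> nat) \<Rightarrow> 'a \<Rightarrow> nat" where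
  "annih_update F T d s X v =
     (if \<exists>e\<in>F. T e = s \<and> d e = v \<and> (\<forall>u\<in>e. X u = 1) then 0 else X v)"

definition ring_times :: "'a set set \<Rightarrow> ('a set \<Rightarrow> real) \<Rightarrow> real \<Rightarrow> real list" where
  "ring_times F T t = sorted_list_of_set {s \<in> T ` F. s \<le> t}"

definition dimer_fin ::
  "'a set set \<Rightarrow> ('a set \<Rightarrow> real) \<Rightarrow> 'a set \<Rightarrow> real \<Rightarrow> 'a \<Rightarrow> nat" where
  "dimer_fin E T A t =
     fold (dimer_update (induced_edges E A) T) (ring_times (induced_edges E A) T t) (\<lambda>_. 0)"

definition annih_fin ::
  "'a set set \<Rightarrow> ('a set \<Rightarrow> real) \<Rightarrow> ('a set \<Rightarrow> 'a) \<Rightarrow> 'a set \<Rightarrow> real \<Rightarrow> 'a \<Rightarrow> nat" where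
  "annih_fin E T d A t =
     fold (annih_update (induced_edges E A) T d) (ring_times (induced_edges E A) T t) (\<lambda>_. 1)"


definition exhausts :: "(nat \<Rightarrow> 'a set) \<Rightarrow> 'a set \<Rightarrow> bool" where
  "exhausts Vs V \<longleftrightarrow>
     (\<forall>n. finite (Vs n) \<and> Vs n \<subseteq> V) \<and> (\<Union>n. \<Inter>m\<in>{n..}. Vs m) = V"

(* For infinite V: the common limit of f along all exhausting sequences. If there
   is no such limit (an event of probability 0 for the processes below), the value
   is an unspecified constant. *)
definition volume_limit :: "('a set \<Rightarrow> nat) \<Rightarrow> 'a set \<Rightarrow> nat" where
  "volume_limit f V =
     (if finite V then f V
      else (THE x. \<forall>Vs. exhausts Vs V \<longrightarrow> (\<lambda>n. f (Vs n)) \<longlonglongrightarrow> x))"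

definition dimer ::
  "'a set set \<Rightarrow> ('a set \<Rightarrow> real) \<Rightarrow> 'a set \<Rightarrow> real \<Rightarrow> 'a \<Rightarrow> nat" where
  "dimer E T V t v = volume_limit (\<lambda>A. dimer_fin E T A t v) V"

definition annih ::
  "'a set set \<Rightarrow> ('a set \<Rightarrow> real) \<Rightarrow> ('a set \<Rightarrow> 'a) \<Rightarrow> 'a set \<Rightarrow> real \<Rightarrow> 'a \<Rightarrow> nat" where
  "annih E T d V t v = volume_limit (\<lambda>A. annih_fin E T d A t v) V"


definition iid_clocks :: "'w measure \<Rightarrow> 'a set set \<Rightarrow> ('a set \<Rightarrow> 'w \<Rightarrow> real) \<Rightarrow> bool" where
  "iid_clocks M E \<tau> \<longleftrightarrow>
     prob_space.indep_vars M (\<lambda>_. borel) \<tau> E \<and>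
     (\<forall>e\<in>E. distr M borel (\<tau> e) = uniform_measure lborel {0<..<1})"

(* Together with the clocks being i.i.d., the product laws of the pairs say that
   each direction is uniform on the two endpoints and independent of all clocks
   and all other directions. *)
definition iid_clocks_dirs ::
  "'w measure \<Rightarrow> 'a set set \<Rightarrow> ('a set \<Rightarrow> 'w \<Rightarrow> real) \<Rightarrow> ('a set \<Rightarrow> 'w \<Rightarrow> 'a) \<Rightarrow> bool" where
  "iid_clocks_dirs M E \<tau> \<delta> \<longleftrightarrow>
     prob_space.indep_vars M (\<lambda>e. borel \<Otimes>\<^sub>M count_space e) (\<lambda>e \<omega>. (\<tau> e \<omega>, \<delta> e \<omega>)) E \<and>
     (\<forall>e\<in>E. distr M (borel \<Otimes>\<^sub>M count_space e) (\<lambda>\<omega>. (\<tau> e \<omega>, \<delta> e \<omega>)) =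
             uniform_measure lborel {0<..<1} \<Otimes>\<^sub>M uniform_count_measure e)"

end

theory Submission
  imports Defs
begin

text \<open>
Let \<open>p t\<close> be the probability that all leaves in \<open>W\<close> are unchanged at time \<open>t\<close>.
A leaf \<open>v\<close> can change only when its single edge \<open>e\<close> rings, and until then the
process on \<open>V\<close> looks, away from \<open>v\<close>, exactly like the process on \<open>V - {v}\<close>,
which does not use the clock of \<open>e\<close> at all. Hence \<open>v\<close> is the first leaf of \<open>W\<close>
to change, at a time in a short interval after \<open>s\<close>, if \<open>e\<close> rings in this
interval (and, for annihilation, \<open>v\<close> is the attacked endpoint) while in the
process on \<open>V - {v}\<close> the neighbour of \<open>v\<close> and the other leaves of \<open>W\<close> are
unchanged at time \<open>s\<close>. By independence, this has probability \<open>c * (s' - s) * q v s\<close>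
for the interval \<open>{s<..s'}\<close>, where \<open>q v s\<close> is the probability in the theorem and
\<open>c\<close> is \<open>1\<close> or \<open>1/2\<close>. The description can fail only if two edges near \<open>W\<close> ring in
the interval, so \<open>p s - p s' = c * (s' - s) * (\<Sum>v\<in>W. q v s)\<close> up to an error of
order \<open>(s' - s)\<^sup>2\<close> (\<open>leaf_prob_increment\<close>). Since a change of state needs a ring
nearby, \<open>q v\<close> is Lipschitz (\<open>near_prob_Lipschitz\<close>), and the derivative
follows (\<open>has_derivative_from_quadratic_error\<close>). Leaves of \<open>W\<close> have different
edges because the graph is connected with more than one edge
(\<open>leaf_edge_inj\<close>); otherwise one ring would be counted twice.

All comparisons between the processes on \<open>V\<close> and \<open>V - {v}\<close> are made for a fixed
realisation of the clocks, directly in infinite volume. An edge is effective if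
no effective edge ringing earlier has changed one of its endpoints. Once this recursion is well founded,
it determines the process in every volume, and in finite volume it agrees with
the processing of the clocks in increasing order (\<open>finite_flip_process_eq\<close>) and
passes to the limit (\<open>flip_process_eq\<close>). Well-foundedness holds almost surely in
a graph of bounded degree (\<open>AE_wf_attacks\<close>).
\<close>

section \<open>Finite volume as a recursion over effective edges\<close>

text \<open>Dimer RSA and annihilation are the same dynamics up to the choice of three
parameters: the initial state \<open>a\<close>, the final state \<open>b\<close>, and the relation
\<open>H e v\<close> telling which endpoints change when \<open>e\<close> acts. Both endpoints change
in dimer RSA, only the attacked one does in the annihilation process.\<close>

definition flip_update ::
  "'a set set \<Rightarrow> ('a set \<Rightarrow> real) \<Rightarrow> ('a set \<Rightarrow> 'a \<Rightarrow> bool) \<Rightarrow> nat \<Rightarrow> nat \<Rightarrow> real \<Rightarrow> ('a \<Rightarrow> nat) \<Rightarrow> 'a \<Rightarrow> nat" where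
  "flip_update F T H a b s X v =
     (if \<exists>e\<in>F. T e = s \<and> H e v \<and> (\<forall>u\<in>e. X u = a) then b else X v)"

lemma dimer_update_eq_flip_update: "dimer_update F T = flip_update F T (\<lambda>e v. v \<in> e) 0 1"
  by (intro ext) (auto simp: dimer_update_def flip_update_def)

lemma annih_update_eq_flip_update: "annih_update F T d = flip_update F T (\<lambda>e v. d e = v) 1 0"
  by (intro ext) (simp add: annih_update_def flip_update_def)

text \<open>The pair \<open>(e', e)\<close> is in the relation if \<open>e'\<close> could prevent \<open>e\<close> from acting:
it rings earlier and would change an endpoint of \<open>e\<close>.\<close>

definition attacks ::
  "'a set set \<Rightarrow> ('a set \<Rightarrow> real) \<Rightarrow> ('a set \<Rightarrow> 'a \<Rightarrow> bool) \<Rightarrow> ('a set \<times> 'a set) set" where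
  "attacks F T H = {(e', e). e' \<in> F \<and> e \<in> F \<and> T e' < T e \<and> (\<exists>u\<in>e. H e' u)}"

text \<open>An edge acts exactly if no edge attacking it has acted. Recursion along
\<open>attacks\<close> makes sense on infinite edge sets as well, wherever the relation is
well founded, so it describes the infinite-volume process without a limit.\<close>

definition effective ::
  "'a set set \<Rightarrow> ('a set \<Rightarrow> real) \<Rightarrow> ('a set \<Rightarrow> 'a \<Rightarrow> bool) \<Rightarrow> 'a set \<Rightarrow> bool" where
  "effective F T H = wfrec (attacks F T H) (\<lambda>f e. \<forall>e'. (e', e) \<in> attacks F T H \<longrightarrow> \<not> f e')"

definition flipped ::
  "'a set set \<Rightarrow> ('a set \<Rightarrow> real) \<Rightarrow> ('a set \<Rightarrow> 'a \<Rightarrow> bool) \<Rightarrow> real \<Rightarrow> 'a \<Rightarrow> bool" where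
  "flipped F T H t v \<longleftrightarrow> (\<exists>e\<in>F. T e \<le> t \<and> H e v \<and> effective F T H e)"

lemma effective_iff:
  assumes "wf (attacks F T H)"
  shows "effective F T H e \<longleftrightarrow> (\<forall>e'. (e', e) \<in> attacks F T H \<longrightarrow> \<not> effective F T H e')"
proof -
  have "effective F T H e = (\<forall>e'. (e', e) \<in> attacks F T H \<longrightarrow>
      \<not> cut (effective F T H) (attacks F T H) e e')"
    unfolding effective_def by (subst wfrec[OF assms]) simp
  then show ?thesis by (auto simp: cut_apply)
qed

lemma wf_attacks_finite:
  assumes "finite F" shows "wf (attacks F T H)"
proof (rule finite_acyclic_wf)
  show "finite (attacks F T H)"
    by (rule finite_subset[of _ "F \<times> F"]) (use assms in \<open>auto simp: attacks_def\<close>)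
  have "T x < T y" if "(x, y) \<in> (attacks F T H)\<^sup>+" for x y
    using that by induction (auto simp: attacks_def)
  then show "acyclic (attacks F T H)" by (force simp: acyclic_def)
qed

text \<open>The hypothesis on \<open>ts\<close> says that it is an initial segment of the ring times;
this is what survives the removal of the last time in the induction. When an
edge rings at the last time \<open>s\<close>, both endpoints are still in state \<open>a\<close> if and
only if no earlier effective edge has changed one of them, which is the
recursion for \<open>effective\<close>. Edges with equal clock values never attack each
other, in agreement with their simultaneous treatment by the update.\<close>

lemma fold_flip_update:
  assumes "finite F" "a \<noteq> b" "sorted_wrt (<) ts" "set ts \<subseteq> T ` F"
    and "\<forall>s\<in>set ts. \<forall>e\<in>F. T e \<le> s \<longrightarrow> T e \<in> set ts"
  shows "fold (flip_update F T H a b) ts (\<lambda>_. a) v =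
           (if \<exists>e\<in>F. T e \<in> set ts \<and> H e v \<and> effective F T H e then b else a)"
  using assms(3-5)
proof (induction ts arbitrary: v rule: rev_induct)
  case (snoc s ts)
  let ?X = "fold (flip_update F T H a b) ts (\<lambda>_. a)"
  have less: "\<forall>s'\<in>set ts. s' < s" and sorted: "sorted_wrt (<) ts"
    using snoc.prems(1) by (auto simp: sorted_wrt_append)
  have before: "T e \<in> set ts \<longleftrightarrow> T e < s" if "e \<in> F" for e
  proof
    assume "T e < s"
    then have "T e \<in> set (ts @ [s])" using snoc.prems(3) that by (auto simp: less_imp_le)
    then show "T e \<in> set ts" using \<open>T e < s\<close> by auto
  qed (use less in simp)
  have closed: "\<forall>s'\<in>set ts. \<forall>e\<in>F. T e \<le> s' \<longrightarrow> T e \<in> set ts"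
    using before less by (meson le_less_trans)
  have IH: "?X v = (if \<exists>e\<in>F. T e \<in> set ts \<and> H e v \<and> effective F T H e then b else a)" for v
    using snoc.IH[OF sorted _ closed] snoc.prems(2) by simp
  have X: "?X u = a \<longleftrightarrow> \<not> (\<exists>e\<in>F. T e < s \<and> H e u \<and> effective F T H e)" for u
  proof -
    have "(\<exists>e\<in>F. T e \<in> set ts \<and> H e u \<and> effective F T H e) \<longleftrightarrow>
        (\<exists>e\<in>F. T e < s \<and> H e u \<and> effective F T H e)"
      using before by blast
    then show ?thesis using IH[of u] \<open>a \<noteq> b\<close> by (cases "?X u = a") (auto split: if_splits)
  qed
  have eff: "(\<forall>u\<in>e. ?X u = a) \<longleftrightarrow> effective F T H e" if "e \<in> F" "T e = s" for e
    unfolding X effective_iff[OF wf_attacks_finite[OF \<open>finite F\<close>], where e=e]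
    using that by (auto simp: attacks_def)
  have now: "(\<exists>e\<in>F. T e = s \<and> H e v \<and> (\<forall>u\<in>e. ?X u = a)) \<longleftrightarrow>
      (\<exists>e\<in>F. T e = s \<and> H e v \<and> effective F T H e)"
    using eff by blast
  have split: "(\<exists>e\<in>F. T e \<in> set (ts @ [s]) \<and> H e v \<and> effective F T H e) \<longleftrightarrow>
      (\<exists>e\<in>F. T e = s \<and> H e v \<and> effective F T H e) \<or>
      (\<exists>e\<in>F. T e \<in> set ts \<and> H e v \<and> effective F T H e)"
    by auto
  have if_if: "(if P then b else if Q then b else a) = (if P \<or> Q then b else a)" for P Q
    by simp
  have "fold (flip_update F T H a b) (ts @ [s]) (\<lambda>_. a) v = flip_update F T H a b s ?X v"
    by simp
  also have "\<dots> = (if \<exists>e\<in>F. T e = s \<and> H e v \<and> effective F T H e then b else ?X v)"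
    unfolding flip_update_def[of F T H a b s] now ..
  also have "\<dots> = (if \<exists>e\<in>F. T e \<in> set (ts @ [s]) \<and> H e v \<and> effective F T H e then b else a)"
    unfolding IH split by (rule if_if)
  finally show ?case .
qed simp

definition finite_flip_process ::
  "'a set set \<Rightarrow> ('a set \<Rightarrow> real) \<Rightarrow> ('a set \<Rightarrow> 'a \<Rightarrow> bool) \<Rightarrow> nat \<Rightarrow> nat \<Rightarrow> 'a set \<Rightarrow> real \<Rightarrow> 'a \<Rightarrow> nat" where
  "finite_flip_process E T H a b A t =
     fold (flip_update (induced_edges E A) T H a b) (ring_times (induced_edges E A) T t) (\<lambda>_. a)"

definition flip_process ::
  "'a set set \<Rightarrow> ('a set \<Rightarrow> real) \<Rightarrow> ('a set \<Rightarrow> 'a \<Rightarrow> bool) \<Rightarrow> nat \<Rightarrow> nat \<Rightarrow> 'a set \<Rightarrow> real \<Rightarrow> 'a \<Rightarrow> nat" where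
  "flip_process E T H a b V t v = volume_limit (\<lambda>A. finite_flip_process E T H a b A t v) V"

lemma dimer_eq_flip_process: "dimer E T V t v = flip_process E T (\<lambda>e v. v \<in> e) 0 1 V t v"
  by (simp add: dimer_def dimer_fin_def flip_process_def finite_flip_process_def
      dimer_update_eq_flip_update)

lemma annih_eq_flip_process: "annih E T d V t v = flip_process E T (\<lambda>e v. d e = v) 1 0 V t v"
  by (simp add: annih_def annih_fin_def flip_process_def finite_flip_process_def
      annih_update_eq_flip_update)

lemma finite_induced_edges: "finite A \<Longrightarrow> finite (induced_edges E A)"
  by (rule finite_subset[of _ "Pow A"]) (auto simp: induced_edges_def)

lemma induced_edges_mono: "A \<subseteq> B \<Longrightarrow> induced_edges E A \<subseteq> induced_edges E B"
  by (auto simp: induced_edges_def)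

lemma attacks_mono: "F \<subseteq> G \<Longrightarrow> attacks F T H \<subseteq> attacks G T H"
  by (auto simp: attacks_def)

lemma finite_flip_process_eq:
  assumes "finite A" "a \<noteq> b"
  shows "finite_flip_process E T H a b A t v =
           (if flipped (induced_edges E A) T H t v then b else a)"
proof -
  let ?F = "induced_edges E A"
  have fin: "finite ?F" using assms(1) by (rule finite_induced_edges)
  then have set_ts: "set (ring_times ?F T t) = {s \<in> T ` ?F. s \<le> t}"
    by (simp add: ring_times_def)
  have "finite_flip_process E T H a b A t v =
      (if \<exists>e\<in>?F. T e \<in> set (ring_times ?F T t) \<and> H e v \<and> effective ?F T H e then b else a)"
    unfolding finite_flip_process_def
  proof (rule fold_flip_update[OF fin \<open>a \<noteq> b\<close>])
    show "sorted_wrt (<) (ring_times ?F T t)" by (simp add: ring_times_def)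
  qed (auto simp: set_ts)
  also have "\<dots> = (if flipped ?F T H t v then b else a)"
    unfolding set_ts flipped_def by (intro if_cong) auto
  finally show ?thesis .
qed

section \<open>The infinite-volume limit\<close>

text \<open>An edge is attacked by finitely many edges only. If each attacker has found
its own finite region outside of which nothing matters, the union of these
regions, enlarged by the attackers and the edge itself, serves for the edge.
Well-founded induction along \<open>attacks\<close> therefore replaces any quantitative
control of the region of influence.\<close>

lemma effective_finite_volume:
  assumes wf: "wf (attacks (induced_edges E V) T H)"
    and loc: "\<And>v. v \<in> V \<Longrightarrow> finite {e \<in> E. v \<in> e}"
    and fin: "\<And>e. e \<in> E \<Longrightarrow> finite e"
    and hit: "\<And>e v. e \<in> E \<Longrightarrow> H e v \<Longrightarrow> v \<in> e"
    and "e \<in> induced_edges E V"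
  shows "\<exists>B. finite B \<and> B \<subseteq> V \<and> (\<forall>A. B \<subseteq> A \<longrightarrow> A \<subseteq> V \<longrightarrow>
           effective (induced_edges E A) T H e = effective (induced_edges E V) T H e)"
  using wf \<open>e \<in> induced_edges E V\<close>
proof (induction e rule: wf_induct_rule)
  case (less e)
  let ?r = "\<lambda>A. attacks (induced_edges E A) T H"
  let ?P = "{e'. (e', e) \<in> ?r V}"
  have e: "e \<in> E" "e \<subseteq> V" using less.prems by (auto simp: induced_edges_def)
  have "?P \<subseteq> (\<Union>u\<in>e. {e' \<in> E. u \<in> e'})"
    using hit by (auto simp: attacks_def induced_edges_def)
  then have finP: "finite ?P"
    by (rule finite_subset) (use e fin loc in auto)
  have "\<forall>e'\<in>?P. \<exists>B. finite B \<and> B \<subseteq> V \<and> (\<forall>A. B \<subseteq> A \<longrightarrow> A \<subseteq> V \<longrightarrow>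
           effective (induced_edges E A) T H e' = effective (induced_edges E V) T H e')"
    using less.IH by (auto simp: attacks_def)
  then obtain B where B: "\<And>e'. e' \<in> ?P \<Longrightarrow> finite (B e') \<and> B e' \<subseteq> V \<and> (\<forall>A. B e' \<subseteq> A \<longrightarrow> A \<subseteq> V \<longrightarrow>
           effective (induced_edges E A) T H e' = effective (induced_edges E V) T H e')"
    by metis
  let ?B = "e \<union> \<Union>?P \<union> (\<Union>e'\<in>?P. B e')"
  show ?case
  proof (intro exI[of _ ?B] conjI allI impI)
    show "finite ?B"
      using finP B e fin by (auto simp: attacks_def induced_edges_def)
    show "?B \<subseteq> V" using B e by (auto simp: attacks_def induced_edges_def)
    fix A assume A: "?B \<subseteq> A" "A \<subseteq> V"
    have wfA: "wf (?r A)"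
      using wf A(2) by (meson wf_subset attacks_mono induced_edges_mono)
    have *: "(e', e) \<in> ?r A \<longleftrightarrow> (e', e) \<in> ?r V" for e'
    proof
      assume "(e', e) \<in> ?r V"
      then have "e' \<subseteq> A" "e \<subseteq> A" using A(1) by auto
      then show "(e', e) \<in> ?r A" using \<open>(e', e) \<in> ?r V\<close> by (auto simp: attacks_def induced_edges_def)
    qed (use A(2) in \<open>auto simp: attacks_def induced_edges_def\<close>)
    have **: "effective (induced_edges E A) T H e' = effective (induced_edges E V) T H e'"
      if "(e', e) \<in> ?r V" for e'
      using B[of e'] that A by blast
    show "effective (induced_edges E A) T H e = effective (induced_edges E V) T H e"
      unfolding effective_iff[OF wfA, of e] effective_iff[OF wf, of e]
      using * ** by auto
  qed
qed

lemma flipped_finite_volume: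
  assumes wf: "wf (attacks (induced_edges E V) T H)"
    and loc: "\<And>v. v \<in> V \<Longrightarrow> finite {e \<in> E. v \<in> e}"
    and fin: "\<And>e. e \<in> E \<Longrightarrow> finite e"
    and hit: "\<And>e v. e \<in> E \<Longrightarrow> H e v \<Longrightarrow> v \<in> e"
    and "v \<in> V"
  shows "\<exists>B. finite B \<and> B \<subseteq> V \<and> (\<forall>A. B \<subseteq> A \<longrightarrow> A \<subseteq> V \<longrightarrow>
           flipped (induced_edges E A) T H t v = flipped (induced_edges E V) T H t v)"
proof -
  let ?P = "{e \<in> induced_edges E V. v \<in> e}"
  have finP: "finite ?P"
    by (rule finite_subset[OF _ loc[OF \<open>v \<in> V\<close>]]) (auto simp: induced_edges_def)
  have "\<forall>e\<in>?P. \<exists>B. finite B \<and> B \<subseteq> V \<and> (\<forall>A. B \<subseteq> A \<longrightarrow> A \<subseteq> V \<longrightarrow>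
           effective (induced_edges E A) T H e = effective (induced_edges E V) T H e)"
    using effective_finite_volume[OF wf loc fin hit] by auto
  then obtain B where B: "\<And>e. e \<in> ?P \<Longrightarrow> finite (B e) \<and> B e \<subseteq> V \<and> (\<forall>A. B e \<subseteq> A \<longrightarrow> A \<subseteq> V \<longrightarrow>
           effective (induced_edges E A) T H e = effective (induced_edges E V) T H e)"
    by metis
  have B1: "finite (B e)" "B e \<subseteq> V" if "e \<in> ?P" for e
    using B[OF that] by blast+
  have B2: "effective (induced_edges E A) T H e = effective (induced_edges E V) T H e"
    if "e \<in> ?P" "B e \<subseteq> A" "A \<subseteq> V" for e A
    using B[OF that(1)] that(2,3) by blast
  let ?B = "\<Union>?P \<union> (\<Union>e\<in>?P. B e)"
  show ?thesis
  proof (intro exI[of _ ?B] conjI allI impI)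
    show "finite ?B" using finP B1(1) fin by (intro finite_UnI finite_Union finite_UN_I) (auto simp: induced_edges_def)
    show "?B \<subseteq> V" using B1(2) by (intro Un_least UN_least Union_least) (auto simp: induced_edges_def)
    fix A assume A: "?B \<subseteq> A" "A \<subseteq> V"
    have *: "e \<in> induced_edges E A \<and> H e v \<longleftrightarrow> e \<in> induced_edges E V \<and> H e v" for e
    proof
      assume h: "e \<in> induced_edges E V \<and> H e v"
      then have "e \<in> ?P" using hit by (auto simp: induced_edges_def)
      then have "e \<subseteq> A" using A(1) by (meson Union_upper le_sup_iff order_trans)
      then show "e \<in> induced_edges E A \<and> H e v" using h by (auto simp: induced_edges_def)
    qed (use A(2) in \<open>auto simp: induced_edges_def\<close>)
    have **: "effective (induced_edges E A) T H e = effective (induced_edges E V) T H e"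
      if "e \<in> induced_edges E V" "H e v" for e
    proof -
      have "e \<in> ?P" using that hit by (auto simp: induced_edges_def)
      then show ?thesis using A by (intro B2) blast+
    qed
    show "flipped (induced_edges E A) T H t v = flipped (induced_edges E V) T H t v"
    proof -
      have "e \<in> induced_edges E A \<and> T e \<le> t \<and> H e v \<and> effective (induced_edges E A) T H e \<longleftrightarrow>
          e \<in> induced_edges E V \<and> T e \<le> t \<and> H e v \<and> effective (induced_edges E V) T H e" for e
        using *[of e] **[of e] by auto
      then show ?thesis unfolding flipped_def Bex_def by simp
    qed
  qed
qed

text \<open>Convergence along the directed set of finite subsets, for values in a
discrete space. Unlike the quantification over all exhausting sequences, this
involves only countably many sets when \<open>V\<close> is countable, so it defines
measurable events.\<close>

definition eventually_volume :: "('a set \<Rightarrow> nat) \<Rightarrow> 'a set \<Rightarrow> nat \<Rightarrow> bool" where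
  "eventually_volume f V x \<longleftrightarrow>
     (\<exists>B. finite B \<and> B \<subseteq> V \<and> (\<forall>A. finite A \<longrightarrow> B \<subseteq> A \<longrightarrow> A \<subseteq> V \<longrightarrow> f A = x))"

lemma exhausts_eventually_superset:
  assumes "exhausts Vs V" "finite B" "B \<subseteq> V"
  shows "\<forall>\<^sub>F n in sequentially. B \<subseteq> Vs n"
proof -
  have "\<forall>\<^sub>F n in sequentially. x \<in> Vs n" if "x \<in> B" for x
    using assms(1,3) that by (force simp: exhausts_def eventually_sequentially)
  then have "\<forall>\<^sub>F n in sequentially. \<forall>x\<in>B. x \<in> Vs n"
    using assms(2) by (simp add: eventually_ball_finite_distrib)
  then show ?thesis by (simp add: subset_eq)
qed

lemma exhausts_between:
  assumes "infinite V" "countable V"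
    and "\<And>n. from_nat_into V ` {..n} \<subseteq> Vs n" "\<And>n. finite (Vs n)" "\<And>n. Vs n \<subseteq> V"
  shows "exhausts Vs V"
proof -
  have "x \<in> (\<Union>n. \<Inter>m\<in>{n..}. Vs m)" if "x \<in> V" for x
  proof -
    obtain k where k: "x = from_nat_into V k"
      using from_nat_into_surj[OF assms(2) \<open>x \<in> V\<close>] by metis
    have "x \<in> Vs m" if "m \<ge> k" for m
      using assms(3)[of m] that k by auto
    then show ?thesis by auto
  qed
  moreover have "(\<Union>n. \<Inter>m\<in>{n..}. Vs m) \<subseteq> V" using assms(5) by fastforce
  ultimately show ?thesis using assms(4,5) unfolding exhausts_def by blast
qed

text \<open>If \<open>f\<close> is not eventually \<open>x\<close>, then beyond the first \<open>n\<close> points of an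
enumeration there is always a finite set with a different value; these sets
form an exhausting sequence along which \<open>f\<close> does not tend to \<open>x\<close>.\<close>

lemma all_limits_iff_eventually_volume:
  assumes "infinite V" "countable V"
  shows "(\<forall>Vs. exhausts Vs V \<longrightarrow> (\<lambda>n. f (Vs n)) \<longlonglongrightarrow> x) \<longleftrightarrow> eventually_volume f V x"
proof
  assume "eventually_volume f V x"
  then obtain B where B: "finite B" "B \<subseteq> V" "\<And>A. finite A \<Longrightarrow> B \<subseteq> A \<Longrightarrow> A \<subseteq> V \<Longrightarrow> f A = x"
    unfolding eventually_volume_def by blast
  show "\<forall>Vs. exhausts Vs V \<longrightarrow> (\<lambda>n. f (Vs n)) \<longlonglongrightarrow> x"
  proof (intro allI impI)
    fix Vs assume Vs: "exhausts Vs V"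
    have "\<forall>\<^sub>F n in sequentially. f (Vs n) = x"
      using exhausts_eventually_superset[OF Vs B(1,2)]
      by eventually_elim (use B(3) Vs in \<open>auto simp: exhausts_def\<close>)
    then show "(\<lambda>n. f (Vs n)) \<longlonglongrightarrow> x" by (rule tendsto_eventually)
  qed
next
  assume lim: "\<forall>Vs. exhausts Vs V \<longrightarrow> (\<lambda>n. f (Vs n)) \<longlonglongrightarrow> x"
  show "eventually_volume f V x"
  proof (rule ccontr)
    assume no: "\<not> eventually_volume f V x"
    have "\<exists>A. finite A \<and> from_nat_into V ` {..n} \<subseteq> A \<and> A \<subseteq> V \<and> f A \<noteq> x" for n
    proof -
      have "from_nat_into V ` {..n} \<subseteq> V"
        using assms(1) by (auto intro!: from_nat_into)
      then show ?thesis using no unfolding eventually_volume_def by blast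
    qed
    then obtain Vs where Vs: "\<And>n. finite (Vs n) \<and> from_nat_into V ` {..n} \<subseteq> Vs n \<and> Vs n \<subseteq> V \<and> f (Vs n) \<noteq> x"
      by metis
    have "exhausts Vs V" by (rule exhausts_between) (use assms Vs in auto)
    then have "(\<lambda>n. f (Vs n)) \<longlonglongrightarrow> x" using lim by blast
    then have "\<forall>\<^sub>F n in sequentially. f (Vs n) = x" by (simp add: tendsto_discrete)
    then show False using Vs by simp
  qed
qed

lemma eventually_volume_unique:
  assumes "eventually_volume f V x" "eventually_volume f V y"
  shows "x = y"
proof -
  obtain B C where B: "finite B" "B \<subseteq> V" "\<And>A. finite A \<Longrightarrow> B \<subseteq> A \<Longrightarrow> A \<subseteq> V \<Longrightarrow> f A = x"
    and C: "finite C" "C \<subseteq> V" "\<And>A. finite A \<Longrightarrow> C \<subseteq> A \<Longrightarrow> A \<subseteq> V \<Longrightarrow> f A = y"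
    using assms unfolding eventually_volume_def by blast
  show ?thesis using B(3)[of "B \<union> C"] C(3)[of "B \<union> C"] B C by auto
qed

text \<open>The second alternative is the value of the definite description when no limit
exists. It is a constant, so the states are measurable also outside the almost
sure event of convergence. Almost sure equality with a measurable function
would not give this in a probability space that is not complete.\<close>

lemma volume_limit_eq_iff:
  assumes "countable V"
  shows "volume_limit f V = x \<longleftrightarrow>
           eventually_volume f V x \<or> (\<forall>y. \<not> eventually_volume f V y) \<and> x = (THE y. False)"
proof (cases "finite V")
  case True
  then have "eventually_volume f V y \<longleftrightarrow> f V = y" for y
    unfolding eventually_volume_def by (metis order_refl subset_antisym)
  then show ?thesis using True by (auto simp: volume_limit_def)
next
  case False
  have *: "volume_limit f V = (THE y. eventually_volume f V y)"
    unfolding volume_limit_def all_limits_iff_eventually_volume[OF False assms] using False by simp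
  show ?thesis
  proof (cases "\<exists>y. eventually_volume f V y")
    case True
    then obtain y where y: "eventually_volume f V y" by blast
    then have "(THE y. eventually_volume f V y) = y"
      using eventually_volume_unique by (intro the_equality) blast+
    then show ?thesis using y eventually_volume_unique * by metis
  next
    case none: False
    then have "eventually_volume f V = (\<lambda>_. False)" by blast
    then show ?thesis unfolding * by auto
  qed
qed

lemma volume_limit_eq:
  assumes "countable V" "eventually_volume f V x"
  shows "volume_limit f V = x"
  using assms by (simp add: volume_limit_eq_iff)

lemma flip_process_eq:
  assumes wf: "wf (attacks (induced_edges E V) T H)"
    and loc: "\<And>v. v \<in> V \<Longrightarrow> finite {e \<in> E. v \<in> e}"
    and fin: "\<And>e. e \<in> E \<Longrightarrow> finite e"
    and hit: "\<And>e v. e \<in> E \<Longrightarrow> H e v \<Longrightarrow> v \<in> e"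
    and "v \<in> V" "countable V" "a \<noteq> b"
  shows "flip_process E T H a b V t v = (if flipped (induced_edges E V) T H t v then b else a)"
  unfolding flip_process_def
proof (rule volume_limit_eq[OF \<open>countable V\<close>])
  obtain B where B: "finite B \<and> B \<subseteq> V \<and> (\<forall>A. B \<subseteq> A \<longrightarrow> A \<subseteq> V \<longrightarrow>
           flipped (induced_edges E A) T H t v = flipped (induced_edges E V) T H t v)"
    using flipped_finite_volume[OF wf loc fin hit \<open>v \<in> V\<close>] ..
  show "eventually_volume (\<lambda>A. finite_flip_process E T H a b A t v) V
     (if flipped (induced_edges E V) T H t v then b else a)"
    unfolding eventually_volume_def
  proof (intro exI[of _ B] conjI allI impI)
    show "finite B" by (rule B[THEN conjunct1])
    show "B \<subseteq> V" by (rule B[THEN conjunct2, THEN conjunct1])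
    fix A assume A: "finite A" "B \<subseteq> A" "A \<subseteq> V"
    have "flipped (induced_edges E A) T H t v = flipped (induced_edges E V) T H t v"
      by (rule B[THEN conjunct2, THEN conjunct2, rule_format, OF A(2,3)])
    then show "finite_flip_process E T H a b A t v =
        (if flipped (induced_edges E V) T H t v then b else a)"
      by (simp only: finite_flip_process_eq[OF A(1) \<open>a \<noteq> b\<close>])
  qed
qed

section \<open>Removal of a leaf\<close>

text \<open>An edge ringing by time \<open>s\<close> is attacked only by edges that ring before \<open>s\<close>, and
none of these contains \<open>v\<close>. So the two recursions coincide up to time \<open>s\<close>.\<close>

lemma effective_remove_leaf:
  assumes wf: "wf (attacks (induced_edges E V) T H)"
    and leaf: "\<And>e. e \<in> E \<Longrightarrow> v \<in> e \<Longrightarrow> T e > s"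
    and "e \<in> induced_edges E (V - {v})" "T e \<le> s"
  shows "effective (induced_edges E V) T H e = effective (induced_edges E (V - {v})) T H e"
proof -
  let ?r = "\<lambda>A. attacks (induced_edges E A) T H"
  have wf': "wf (?r (V - {v}))"
    by (rule wf_subset[OF wf]) (intro attacks_mono induced_edges_mono, auto)
  show ?thesis
    using wf' assms(3,4)
  proof (induction e rule: wf_induct_rule)
    case (less e)
    have *: "(e', e) \<in> ?r V \<longleftrightarrow> (e', e) \<in> ?r (V - {v})" for e'
      using less.prems leaf[of e'] by (auto simp: attacks_def induced_edges_def)
    have **: "effective (induced_edges E V) T H e' = effective (induced_edges E (V - {v})) T H e'"
      if "(e', e) \<in> ?r (V - {v})" for e'
      by (rule less.IH[OF that]) (use that less.prems in \<open>auto simp: attacks_def\<close>)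
    show ?case
      unfolding effective_iff[OF wf, of e] effective_iff[OF wf', of e] using * ** by auto
  qed
qed

lemma flipped_remove_leaf:
  assumes wf: "wf (attacks (induced_edges E V) T H)"
    and leaf: "\<And>e. e \<in> E \<Longrightarrow> v \<in> e \<Longrightarrow> T e > s"
  shows "flipped (induced_edges E V) T H s w = flipped (induced_edges E (V - {v})) T H s w"
proof -
  have "e \<in> induced_edges E V \<and> T e \<le> s \<longleftrightarrow> e \<in> induced_edges E (V - {v}) \<and> T e \<le> s" for e
    using leaf[of e] by (auto simp: induced_edges_def)
  then show ?thesis
    unfolding flipped_def using effective_remove_leaf[OF wf leaf] by (metis (no_types, lifting))
qed

section \<open>Independent clocks and measurability\<close>

text \<open>The probabilistic input common to both processes. The family \<open>S e\<close> consists of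
the events determined by the randomness attached to the edge \<open>e\<close>, and \<open>c\<close> is
the probability that a ringing edge changes a given endpoint: \<open>1\<close> for dimer
RSA and \<open>1/2\<close> for the annihilation process.\<close>

locale random_flip_graph = prob_space M
  for M :: "'w measure" +
  fixes V :: "'a set" and E :: "'a set set"
    and \<tau> :: "'a set \<Rightarrow> 'w \<Rightarrow> real" and H :: "'w \<Rightarrow> 'a set \<Rightarrow> 'a \<Rightarrow> bool"
    and S :: "'a set \<Rightarrow> 'w set set" and c :: real
  assumes simple: "simple_graph V E" and countable_V: "countable V"
    and bounded: "bounded_degree V E"
    and indep: "indep_sets S E"
    and Int_stable: "e \<in> E \<Longrightarrow> Int_stable (S e)"
    and clock_sets: "e \<in> E \<Longrightarrow> B \<in> sets borel \<Longrightarrow> {\<omega> \<in> space M. \<tau> e \<omega> \<in> B} \<in> S e"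
    and hit_sets: "e \<in> E \<Longrightarrow> {\<omega> \<in> space M. H \<omega> e v} \<in> S e"
    and hit_endpoint: "\<omega> \<in> space M \<Longrightarrow> e \<in> E \<Longrightarrow> H \<omega> e v \<Longrightarrow> v \<in> e"
    and clock_uniform: "e \<in> E \<Longrightarrow> B \<in> sets borel \<Longrightarrow>
      prob {\<omega> \<in> space M. \<tau> e \<omega> \<in> B} = measure lborel ({0<..<1} \<inter> B)"
    and hit_prob: "e \<in> E \<Longrightarrow> v \<in> e \<Longrightarrow> B \<in> sets borel \<Longrightarrow>
      prob {\<omega> \<in> space M. \<tau> e \<omega> \<in> B \<and> H \<omega> e v} = c * measure lborel ({0<..<1} \<inter> B)"
begin

lemma edgeD: "e \<in> E \<Longrightarrow> e \<subseteq> V" "e \<in> E \<Longrightarrow> finite e" "e \<in> E \<Longrightarrow> card e = 2"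
  using simple by (auto simp: simple_graph_def intro: card_ge_0_finite)

lemma finite_incident: "v \<in> V \<Longrightarrow> finite {e \<in> E. v \<in> e}"
  using bounded by (auto simp: bounded_degree_def)

lemma S_events: "e \<in> E \<Longrightarrow> S e \<subseteq> events"
  using indep by (auto simp: indep_sets_def)

text \<open>The events that depend on the randomness of the edges in \<open>D\<close> only. Both the
measurability of the states and the independence of a leaf edge from the rest
of the graph are read off from these algebras.\<close>

definition edge_algebra :: "'a set set \<Rightarrow> 'w measure" where
  "edge_algebra D = sigma (space M) (\<Union>e\<in>D. S e)"

lemma space_edge_algebra [simp]: "space (edge_algebra D) = space M"
  by (simp add: edge_algebra_def space_measure_of_conv)

lemma sets_edge_algebra:
  assumes "D \<subseteq> E"
  shows "sets (edge_algebra D) = sigma_sets (space M) (\<Union>e\<in>D. S e)"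
proof -
  have "(\<Union>e\<in>D. S e) \<subseteq> Pow (space M)"
    using assms S_events sets.space_closed by blast
  then show ?thesis by (simp add: edge_algebra_def sets_measure_of)
qed

lemma edge_algebra_events:
  assumes "D \<subseteq> E" shows "sets (edge_algebra D) \<subseteq> events"
  unfolding sets_edge_algebra[OF assms]
  by (rule sets.sigma_sets_subset) (use assms S_events in blast)

lemma S_edge_algebra: "D \<subseteq> E \<Longrightarrow> e \<in> D \<Longrightarrow> S e \<subseteq> sets (edge_algebra D)"
  by (auto simp: sets_edge_algebra intro!: sigma_sets.Basic)

lemma pred_edge_algebra_events:
  assumes "D \<subseteq> E" "Measurable.pred (edge_algebra D) P"
  shows "{\<omega> \<in> space M. P \<omega>} \<in> events"
  using edge_algebra_events[OF assms(1)] assms(2) by (auto simp: pred_def)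

lemma clock_measurable:
  assumes "D \<subseteq> E" "e \<in> D"
  shows "\<tau> e \<in> borel_measurable (edge_algebra D)"
proof (rule measurableI)
  fix B :: "real set" assume "B \<in> sets borel"
  then have "{\<omega> \<in> space M. \<tau> e \<omega> \<in> B} \<in> sets (edge_algebra D)"
    using clock_sets S_edge_algebra[OF assms] assms by blast
  then show "\<tau> e -` B \<inter> space (edge_algebra D) \<in> sets (edge_algebra D)"
    by (simp add: vimage_def Int_def conj_commute)
qed simp

lemma hit_measurable:
  assumes "D \<subseteq> E" "e \<in> D"
  shows "Measurable.pred (edge_algebra D) (\<lambda>\<omega>. H \<omega> e v)"
  using hit_sets S_edge_algebra[OF assms] assms by (auto simp: pred_def)

text \<open>A finite-volume state depends on the clocks through finitely many comparisons.
Treating the whole relation as a random variable with finitely many values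
makes everything computed from it measurable, with no analysis of the
recursion.\<close>

lemma attacks_measurable:
  assumes "D \<subseteq> E" "F \<subseteq> D" "finite F"
  shows "(\<lambda>\<omega>. attacks F (\<lambda>e. \<tau> e \<omega>) (H \<omega>)) \<in> measurable (edge_algebra D) (count_space (Pow (F \<times> F)))"
    (is "?r \<in> _")
proof -
  have mem: "Measurable.pred (edge_algebra D) (\<lambda>\<omega>. p \<in> ?r \<omega>)" if p: "p \<in> F \<times> F" for p
  proof -
    obtain e' e where [simp]: "p = (e', e)" and e: "e' \<in> F" "e \<in> F" "e' \<in> D" "e \<in> D"
      using p assms(2) by (cases p) auto
    have [measurable]: "\<tau> e' \<in> borel_measurable (edge_algebra D)"
      "\<tau> e \<in> borel_measurable (edge_algebra D)"
      "Measurable.pred (edge_algebra D) (\<lambda>\<omega>. H \<omega> e' u)" for u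
      using clock_measurable hit_measurable assms(1) e by blast+
    have "finite e" using edgeD e assms by blast
    then have "Measurable.pred (edge_algebra D) (\<lambda>\<omega>. \<tau> e' \<omega> < \<tau> e \<omega> \<and> (\<exists>u\<in>e. H \<omega> e' u))"
      by measurable
    then show ?thesis using e by (simp add: attacks_def)
  qed
  have "?r -` {r} \<inter> space (edge_algebra D) \<in> sets (edge_algebra D)" if r: "r \<subseteq> F \<times> F" for r
  proof -
    have "?r \<omega> = r \<longleftrightarrow> (\<forall>p\<in>F \<times> F. (p \<in> ?r \<omega>) = (p \<in> r))" for \<omega>
      using r by (auto simp: attacks_def)
    then have "?r -` {r} \<inter> space (edge_algebra D) =
        {\<omega> \<in> space (edge_algebra D). \<forall>p\<in>F \<times> F. (p \<in> ?r \<omega>) = (p \<in> r)}"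
      by auto
    moreover have "Measurable.pred (edge_algebra D) (\<lambda>\<omega>. \<forall>p\<in>F \<times> F. (p \<in> ?r \<omega>) = (p \<in> r))"
      using mem assms(3) by (intro pred_intros_finite pred_intros_logic) auto
    ultimately show ?thesis by (simp add: pred_def)
  qed
  moreover have "?r \<in> space (edge_algebra D) \<rightarrow> Pow (F \<times> F)"
    by (auto simp: attacks_def)
  ultimately show ?thesis
    using assms(3) by (subst measurable_count_space_eq2) auto
qed

lemma flipped_measurable:
  assumes "D \<subseteq> E" "F \<subseteq> D" "finite F"
  shows "Measurable.pred (edge_algebra D) (\<lambda>\<omega>. flipped F (\<lambda>e. \<tau> e \<omega>) (H \<omega>) t v)"
  unfolding flipped_def
proof (intro pred_intros_finite(4)[OF assms(3)] pred_intros_logic)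
  fix e assume "e \<in> F"
  then have e: "e \<in> D" using assms by blast
  have [measurable]: "\<tau> e \<in> borel_measurable (edge_algebra D)"
    by (rule clock_measurable[OF assms(1) e])
  show "Measurable.pred (edge_algebra D) (\<lambda>\<omega>. \<tau> e \<omega> \<le> t)" by measurable
  show "Measurable.pred (edge_algebra D) (\<lambda>\<omega>. H \<omega> e v)"
    by (rule hit_measurable[OF assms(1) e])
  have "Measurable.pred (count_space (Pow (F \<times> F)))
      (\<lambda>r. wfrec r (\<lambda>f e. \<forall>e'. (e', e) \<in> r \<longrightarrow> \<not> f e') e)"
    by (auto simp: pred_def)
  then show "Measurable.pred (edge_algebra D) (\<lambda>\<omega>. effective F (\<lambda>e. \<tau> e \<omega>) (H \<omega>) e)"
    unfolding effective_def
    by (rule measurable_compose[OF attacks_measurable[OF assms]])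
qed

text \<open>The sharp algebra matters: the process on \<open>V'\<close> is determined by the edges
inside \<open>V'\<close>, hence independent of every other edge.\<close>

lemma flip_process_measurable:
  assumes "V' \<subseteq> V" "induced_edges E V' \<subseteq> D" "D \<subseteq> E" "a \<noteq> b"
  shows "Measurable.pred (edge_algebra D) (\<lambda>\<omega>. flip_process E (\<lambda>e. \<tau> e \<omega>) (H \<omega>) a b V' t v = x)"
proof -
  let ?f = "\<lambda>\<omega> A. finite_flip_process E (\<lambda>e. \<tau> e \<omega>) (H \<omega>) a b A t v"
  let ?Fin = "\<lambda>B. {A. finite A \<and> B \<subseteq> A \<and> A \<subseteq> V'}"
  have V': "countable V'" using assms(1) countable_V countable_subset by blast
  have fin: "Measurable.pred (edge_algebra D) (\<lambda>\<omega>. ?f \<omega> A = y)" if A: "finite A" "A \<subseteq> V'" for A y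
  proof -
    have "induced_edges E A \<subseteq> D" using A assms(2) induced_edges_mono by blast
    then have [measurable]: "Measurable.pred (edge_algebra D)
        (\<lambda>\<omega>. flipped (induced_edges E A) (\<lambda>e. \<tau> e \<omega>) (H \<omega>) t v)"
      using A assms(3) by (intro flipped_measurable finite_induced_edges)
    show ?thesis unfolding finite_flip_process_eq[OF A(1) assms(4)] by measurable
  qed
  have cFin: "countable (?Fin B)" for B
    by (rule countable_subset[OF _ countable_Collect_finite_subset[OF V']]) auto
  have ev: "Measurable.pred (edge_algebra D) (\<lambda>\<omega>. eventually_volume (?f \<omega>) V' y)" for y
  proof -
    have "eventually_volume (?f \<omega>) V' y \<longleftrightarrow> (\<exists>B\<in>?Fin {}. \<forall>A\<in>?Fin B. ?f \<omega> A = y)" for \<omega>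
      by (simp add: eventually_volume_def Bex_def Ball_def imp_conjL)
    moreover have "Measurable.pred (edge_algebra D) (\<lambda>\<omega>. \<exists>B\<in>?Fin {}. \<forall>A\<in>?Fin B. ?f \<omega> A = y)"
      unfolding pred_def
      by (intro sets.sets_Collect_countable_Ex' sets.sets_Collect_countable_All' cFin)
        (use fin in \<open>auto simp: pred_def\<close>)
    ultimately show ?thesis by simp
  qed
  show ?thesis
    unfolding flip_process_def volume_limit_eq_iff[OF V']
    by (intro pred_intros_logic pred_intros_countable ev) simp_all
qed

lemma prob_edge_algebra_indep:
  assumes "D \<subseteq> E" "e \<in> E" "e \<notin> D" "A \<in> sets (edge_algebra D)" "B \<in> sets (edge_algebra {e})"
  shows "prob (A \<inter> B) = prob A * prob B"
proof -
  let ?I = "case_bool D {e}"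
  have "indep_sets S (\<Union>j\<in>UNIV. ?I j)"
    by (rule indep_sets_mono_index[OF _ indep]) (use assms in \<open>auto split: bool.splits\<close>)
  then have "indep_sets (\<lambda>j. sigma_sets (space M) (\<Union>i\<in>?I j. S i)) UNIV"
    by (rule indep_sets_collect_sigma)
      (use assms Int_stable in \<open>auto simp: disjoint_family_on_def split: bool.splits\<close>)
  moreover have "(\<lambda>j. sigma_sets (space M) (\<Union>i\<in>?I j. S i)) =
      case_bool (sets (edge_algebra D)) (sets (edge_algebra {e}))"
    using assms by (auto simp: sets_edge_algebra fun_eq_iff split: bool.splits)
  ultimately have "indep_set (sets (edge_algebra D)) (sets (edge_algebra {e}))"
    unfolding indep_set_def by simp
  then show ?thesis using assms by (intro indep_setD)
qed

lemma prob_clock_le: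
  assumes "e \<in> E" "x \<le> y"
  shows "prob {\<omega> \<in> space M. \<tau> e \<omega> \<in> {x..y}} \<le> y - x"
proof -
  have "measure lborel ({0<..<1} \<inter> {x..y}) \<le> measure lborel {x..y}"
    using assms(2) by (intro measure_mono_fmeasurable) (auto simp: fmeasurable_def)
  then show ?thesis using clock_uniform[OF assms(1), of "{x..y}"] assms(2) by simp
qed

lemma prob_clock_Ioc:
  assumes "e \<in> E" "0 \<le> x" "x \<le> y" "y < 1"
  shows "prob {\<omega> \<in> space M. \<tau> e \<omega> \<in> {x<..y}} = y - x"
proof -
  have "{0<..<1} \<inter> {x<..y} = {x<..y}" using assms by auto
  then show ?thesis using clock_uniform[OF assms(1), of "{x<..y}"] assms(3) by simp
qed

lemma AE_clock_in_unit: "AE \<omega> in M. \<forall>e\<in>E. 0 < \<tau> e \<omega> \<and> \<tau> e \<omega> < 1"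
proof -
  have "countable E"
    by (rule countable_subset[OF _ countable_Collect_finite_subset[OF countable_V]])
      (use edgeD in auto)
  moreover have "AE \<omega> in M. 0 < \<tau> e \<omega> \<and> \<tau> e \<omega> < 1" if "e \<in> E" for e
  proof -
    have "prob {\<omega> \<in> space M. \<tau> e \<omega> \<in> {0<..<1}} = 1"
      using clock_uniform[OF that, of "{0<..<1}"] by simp
    moreover have "{\<omega> \<in> space M. \<tau> e \<omega> \<in> {0<..<1}} \<in> events"
      using clock_sets[OF that, of "{0<..<1}"] S_events[OF that] by auto
    ultimately have "AE \<omega> in M. \<omega> \<in> {\<omega> \<in> space M. \<tau> e \<omega> \<in> {0<..<1}}"
      by (simp add: prob_eq_1)
    then show ?thesis by eventually_elim auto
  qed
  ultimately show ?thesis by (simp add: AE_ball_countable)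
qed

end

section \<open>Almost sure absence of infinite decreasing chains\<close>

text \<open>Sequences of \<open>n + 1\<close> edges starting at \<open>e\<close> in which consecutive edges meet; any
infinite descending chain of attacks starts with such sequences.\<close>

primrec edge_chains :: "'a set set \<Rightarrow> nat \<Rightarrow> 'a set \<Rightarrow> 'a set list set" where
  "edge_chains E 0 e = {[e]}"
| "edge_chains E (Suc n) e = (\<Union>e'\<in>{e' \<in> E. e \<inter> e' \<noteq> {}}. (#) e ` edge_chains E n e')"

lemma edge_chainsD:
  assumes "xs \<in> edge_chains E n e" "e \<in> E"
  shows "length xs = Suc n" "set xs \<subseteq> E"
proof -
  have "length xs = Suc n \<and> set xs \<subseteq> E"
    using assms by (induction n arbitrary: xs e) force+
  then show "length xs = Suc n" "set xs \<subseteq> E" by auto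
qed

lemma edge_chains_finite_card:
  assumes "\<And>e. e \<in> E \<Longrightarrow> finite {e' \<in> E. e \<inter> e' \<noteq> {}} \<and> card {e' \<in> E. e \<inter> e' \<noteq> {}} \<le> N"
    and "e \<in> E"
  shows "finite (edge_chains E n e) \<and> card (edge_chains E n e) \<le> N ^ n"
  using assms(2)
proof (induction n arbitrary: e)
  case (Suc n)
  let ?nb = "{e' \<in> E. e \<inter> e' \<noteq> {}}"
  have nb: "finite ?nb" "card ?nb \<le> N" using assms(1)[OF Suc.prems] by auto
  have IH: "finite (edge_chains E n e')" "card (edge_chains E n e') \<le> N ^ n" if "e' \<in> ?nb" for e'
    using Suc.IH[of e'] that by auto
  have "card (edge_chains E (Suc n) e) \<le> (\<Sum>e'\<in>?nb. card ((#) e ` edge_chains E n e'))"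
    using nb by (simp add: card_UN_le)
  also have "\<dots> \<le> (\<Sum>e'\<in>?nb. N ^ n)"
    using IH by (intro sum_mono) (meson card_image_le le_trans)
  also have "\<dots> \<le> N * N ^ n" using nb(2) by simp
  finally show ?case using nb IH by simp
qed simp

lemma map_upt_edge_chains:
  assumes "\<And>i. f i \<in> E" "\<And>i. f i \<inter> f (Suc i) \<noteq> {}"
  shows "map f [m..<m + Suc n] \<in> edge_chains E n (f m)"
proof (induction n arbitrary: m)
  case (Suc n)
  have eq: "map f [m..<m + Suc (Suc n)] = f m # map f [Suc m..<Suc m + Suc n]"
    by (subst upt_conv_Cons) (auto simp del: upt_Suc)
  show ?case
    unfolding eq edge_chains.simps
  proof (rule UN_I)
    show "f (Suc m) \<in> {e' \<in> E. f m \<inter> e' \<noteq> {}}" using assms by simp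
  qed (rule imageI, rule Suc)
qed simp

lemma nat_antimono_stabilizes:
  fixes f :: "nat \<Rightarrow> nat"
  assumes "\<And>i. f (Suc i) \<le> f i"
  obtains m where "\<And>i. i \<ge> m \<Longrightarrow> f i = f m"
proof -
  obtain m where m: "\<And>i. f m \<le> f i"
    using ex_has_least_nat[of "\<lambda>_. True" _ f] by auto
  then have "f i = f m" if "i \<ge> m" for i
    using m[of i] lift_Suc_antimono_le[of f m i] assms that by (simp add: le_antisym)
  then show ?thesis by (rule that)
qed

context random_flip_graph
begin

lemma edge_near_bound:
  "\<exists>N. \<forall>e\<in>E. finite {e' \<in> E. e \<inter> e' \<noteq> {}} \<and> card {e' \<in> E. e \<inter> e' \<noteq> {}} \<le> N"
proof -
  obtain d where d: "\<forall>v\<in>V. finite {e \<in> E. v \<in> e} \<and> card {e \<in> E. v \<in> e} \<le> d"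
    using bounded by (auto simp: bounded_degree_def vertex_degree_def)
  show ?thesis
  proof (intro exI[of _ "2 * d"] ballI)
    fix e assume e: "e \<in> E"
    have eq: "{e' \<in> E. e \<inter> e' \<noteq> {}} = (\<Union>u\<in>e. {e' \<in> E. u \<in> e'})" by auto
    have "card (\<Union>u\<in>e. {e' \<in> E. u \<in> e'}) \<le> (\<Sum>u\<in>e. card {e' \<in> E. u \<in> e'})"
      by (rule card_UN_le) (rule edgeD(2)[OF e])
    also have "\<dots> \<le> (\<Sum>u\<in>e. d)"
      using d edgeD(1)[OF e] by (intro sum_mono) auto
    also have "\<dots> = 2 * d" using edgeD(3)[OF e] by simp
    finally show "finite {e' \<in> E. e \<inter> e' \<noteq> {}} \<and> card {e' \<in> E. e \<inter> e' \<noteq> {}} \<le> 2 * d"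
      unfolding eq using d edgeD[OF e] by auto
  qed
qed

text \<open>Distinctness makes the clocks of a chain independent; it is automatic for
chains with decreasing clocks.\<close>

definition chain_in :: "real set \<Rightarrow> nat \<Rightarrow> 'a set \<Rightarrow> 'w set" where
  "chain_in I n e = (\<Union>xs\<in>{xs \<in> edge_chains E n e. distinct xs}. \<Inter>x\<in>set xs. {\<omega> \<in> space M. \<tau> x \<omega> \<in> I})"

lemma clock_events: "e \<in> E \<Longrightarrow> B \<in> sets borel \<Longrightarrow> {\<omega> \<in> space M. \<tau> e \<omega> \<in> B} \<in> events"
  using clock_sets S_events by blast

lemma prob_clocks_le:
  assumes "finite D" "D \<subseteq> E" "D \<noteq> {}" "x \<le> y"
  shows "prob (\<Inter>e\<in>D. {\<omega> \<in> space M. \<tau> e \<omega> \<in> {x..y}}) \<le> (y - x) ^ card D"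
proof -
  have "prob (\<Inter>e\<in>D. {\<omega> \<in> space M. \<tau> e \<omega> \<in> {x..y}}) =
      (\<Prod>e\<in>D. prob {\<omega> \<in> space M. \<tau> e \<omega> \<in> {x..y}})"
    by (rule indep_setsD[OF indep]) (use assms clock_sets[of _ "{x..y}"] in auto)
  also have "\<dots> \<le> (\<Prod>e\<in>D. y - x)"
    using assms prob_clock_le by (intro prod_mono) auto
  finally show ?thesis by simp
qed

lemma chain_in_bound:
  assumes N: "\<And>e. e \<in> E \<Longrightarrow> finite {e' \<in> E. e \<inter> e' \<noteq> {}} \<and> card {e' \<in> E. e \<inter> e' \<noteq> {}} \<le> N"
    and "e \<in> E" "x \<le> y"
  shows "chain_in {x..y} n e \<in> events" "prob (chain_in {x..y} n e) \<le> real N ^ n * (y - x) ^ Suc n"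
proof -
  let ?C = "{xs \<in> edge_chains E n e. distinct xs}"
  let ?A = "\<lambda>xs. \<Inter>x'\<in>set xs. {\<omega> \<in> space M. \<tau> x' \<omega> \<in> {x..y}}"
  have C: "finite ?C" "card ?C \<le> N ^ n"
    using edge_chains_finite_card[OF N \<open>e \<in> E\<close>, of n]
    by (auto intro: order_trans[OF card_mono])
  have xs: "length xs = Suc n" "set xs \<subseteq> E" "xs \<noteq> []" if "xs \<in> ?C" for xs
    using edge_chainsD[of xs E n e] that \<open>e \<in> E\<close> by auto
  have A: "?A xs \<in> events" if "xs \<in> ?C" for xs
    using xs[OF that] by (intro sets.finite_INT clock_events) auto
  then show "chain_in {x..y} n e \<in> events"
    unfolding chain_in_def using C by (intro sets.finite_UN) auto
  have "prob (chain_in {x..y} n e) \<le> (\<Sum>xs\<in>?C. prob (?A xs))"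
    unfolding chain_in_def using C A by (intro finite_measure_subadditive_finite) auto
  also have "\<dots> \<le> (\<Sum>xs\<in>?C. (y - x) ^ Suc n)"
  proof (rule sum_mono)
    fix xs assume "xs \<in> ?C"
    then have "card (set xs) = Suc n" using xs(1) by (simp add: distinct_card)
    then show "prob (?A xs) \<le> (y - x) ^ Suc n"
      using prob_clocks_le[of "set xs" x y] xs[OF \<open>xs \<in> ?C\<close>] \<open>x \<le> y\<close> by auto
  qed
  also have "\<dots> \<le> real N ^ n * (y - x) ^ Suc n"
    using C(2) \<open>x \<le> y\<close> by (auto intro!: mult_right_mono simp flip: of_nat_power)
  finally show "prob (chain_in {x..y} n e) \<le> real N ^ n * (y - x) ^ Suc n" .
qed

text \<open>An infinite descending chain has decreasing clocks in the unit interval. If the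
interval is cut into windows of length \<open>1 / K\<close>, some tail of the chain has all
its clocks in one window. A given edge starts at most \<open>N ^ n\<close> chains with
\<open>n + 1\<close> edges, and each of them has all clocks in a given window with
probability at most \<open>(1 / K) ^ (n + 1)\<close>. With \<open>K > 2 * N\<close> the expected number of such
chains tends to \<open>0\<close>, so almost surely, for all of the countably many edges and
windows, there is no infinite chain.\<close>

lemma AE_wf_attacks:
  "AE \<omega> in M. wf (attacks E (\<lambda>e. \<tau> e \<omega>) (H \<omega>))"
proof -
  obtain N where N: "\<And>e. e \<in> E \<Longrightarrow> finite {e' \<in> E. e \<inter> e' \<noteq> {}} \<and> card {e' \<in> E. e \<inter> e' \<noteq> {}} \<le> N"
    using edge_near_bound by blast
  define K where "K = 2 * (real N + 1)"
  have K: "K > 0" "real N / K \<le> 1/2" "1 / K \<le> 1" by (auto simp: K_def field_simps)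
  define I where "I k = {real k / K .. (real k + 1) / K}" for k :: nat
  have cE: "countable E"
    by (rule countable_subset[OF _ countable_Collect_finite_subset[OF countable_V]])
      (use edgeD in auto)
  have "AE \<omega> in M. \<exists>n. \<omega> \<notin> chain_in (I k) n e" if e: "e \<in> E" for k e
  proof -
    let ?Z = "\<Inter>n. chain_in (I k) n e"
    have le: "real k / K \<le> (real k + 1) / K" using K by (simp add: divide_right_mono)
    have ev: "chain_in (I k) n e \<in> events" for n
      unfolding I_def by (rule chain_in_bound[OF N e le])
    have "prob ?Z \<le> (1/2) ^ n" for n
    proof -
      have "prob ?Z \<le> prob (chain_in (I k) n e)"
        by (rule finite_measure_mono[OF _ ev]) auto
      also have "\<dots> \<le> real N ^ n * ((real k + 1) / K - real k / K) ^ Suc n"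
        unfolding I_def by (rule chain_in_bound[OF N e le])
      also have "\<dots> = (real N / K) ^ n * (1 / K)"
        by (simp add: add_divide_distrib power_divide)
      also have "\<dots> \<le> (1/2) ^ n * 1"
        using K by (intro mult_mono power_mono) auto
      finally show ?thesis by simp
    qed
    moreover have "(\<lambda>n. (1/2::real) ^ n) \<longlonglongrightarrow> 0" by (rule LIMSEQ_realpow_zero) auto
    ultimately have "prob ?Z \<le> 0"
      by (intro LIMSEQ_le_const[of "\<lambda>n. (1/2::real) ^ n"]) auto
    then have "prob ?Z = 0" using measure_nonneg[of M ?Z] by linarith
    moreover have "?Z \<in> events" using ev by (intro sets.countable_INT) auto
    ultimately have "AE \<omega> in M. \<omega> \<notin> ?Z" by (simp add: prob_eq_0)
    then show ?thesis by eventually_elim auto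
  qed
  then have "AE \<omega> in M. \<forall>e\<in>E. \<forall>k. \<exists>n. \<omega> \<notin> chain_in (I k) n e"
    by (simp add: AE_ball_countable[OF cE] AE_all_countable)
  with AE_clock_in_unit AE_space show ?thesis
  proof eventually_elim
    case (elim \<omega>)
    show ?case
    proof (rule ccontr)
      assume "\<not> wf (attacks E (\<lambda>e. \<tau> e \<omega>) (H \<omega>))"
      then obtain f where "\<And>i. (f (Suc i), f i) \<in> attacks E (\<lambda>e. \<tau> e \<omega>) (H \<omega>)"
        unfolding wf_iff_no_infinite_down_chain by blast
      then have f: "f i \<in> E" "\<tau> (f (Suc i)) \<omega> < \<tau> (f i) \<omega>" "f i \<inter> f (Suc i) \<noteq> {}" for i
        using hit_endpoint[OF elim(2)] by (fastforce simp: attacks_def)+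
      have decr: "\<tau> (f j) \<omega> < \<tau> (f i) \<omega>" if "i < j" for i j
        using that by (rule lift_Suc_mono_less[of "\<lambda>i. - \<tau> (f i) \<omega>", simplified, rotated]) (rule f)
      have pos: "0 \<le> K * \<tau> (f i) \<omega>" for i
        using elim(1) f(1) K(1) by (simp add: less_imp_le)
      \<comment> \<open>The number of the window containing the clock decreases along the chain, so it stabilizes.\<close>
      have "nat \<lfloor>K * \<tau> (f (Suc i)) \<omega>\<rfloor> \<le> nat \<lfloor>K * \<tau> (f i) \<omega>\<rfloor>" for i
        using f(2)[of i] K(1) by (intro nat_mono floor_mono) simp
      then obtain m where m: "\<And>i. i \<ge> m \<Longrightarrow> nat \<lfloor>K * \<tau> (f i) \<omega>\<rfloor> = nat \<lfloor>K * \<tau> (f m) \<omega>\<rfloor>"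
        using nat_antimono_stabilizes[of "\<lambda>i. nat \<lfloor>K * \<tau> (f i) \<omega>\<rfloor>"] by metis
      define k where "k = nat \<lfloor>K * \<tau> (f m) \<omega>\<rfloor>"
      have I: "\<tau> (f i) \<omega> \<in> I k" if "i \<ge> m" for i
      proof -
        have "k = nat \<lfloor>K * \<tau> (f i) \<omega>\<rfloor>" using m[OF that] by (simp only: k_def)
        then have "real k = of_int \<lfloor>K * \<tau> (f i) \<omega>\<rfloor>" using pos[of i] by simp
        then have "real k \<le> K * \<tau> (f i) \<omega>" "K * \<tau> (f i) \<omega> \<le> real k + 1"
          using pos[of i] by linarith+
        then show ?thesis using K(1) by (simp add: I_def field_simps)
      qed
      have "\<omega> \<in> chain_in (I k) n (f m)" for n
        unfolding chain_in_def
      proof (rule UN_I)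
        let ?xs = "map f [m..<m + Suc n]"
        have "inj_on f {m..<m + Suc n}"
        proof (rule inj_onI)
          fix i j assume "f i = f j"
          then show "i = j" using decr[of i j] decr[of j i] by (cases i j rule: linorder_cases) auto
        qed
        then show "?xs \<in> {xs \<in> edge_chains E n (f m). distinct xs}"
          using map_upt_edge_chains[of f E m n] f by (simp add: distinct_map del: upt_Suc)
        show "\<omega> \<in> (\<Inter>x\<in>set ?xs. {\<omega> \<in> space M. \<tau> x \<omega> \<in> I k})"
          using I elim(2) by auto
      qed
      then show False using elim(3) f(1) by blast
    qed
  qed
qed

end

section \<open>The first change of a leaf\<close>

text \<open>The hypothesis on \<open>p\<close> uses the value of \<open>q\<close> at the left end of the interval.
For the left derivative at \<open>t\<close> that value must be moved to \<open>t\<close>, which costs a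
second quadratic error by the Lipschitz bound.\<close>

lemma has_derivative_from_quadratic_error:
  fixes p q :: "real \<Rightarrow> real"
  assumes p: "\<And>x y. 0 \<le> x \<Longrightarrow> x \<le> y \<Longrightarrow> y < 1 \<Longrightarrow> \<bar>p x - p y - (y - x) * q x\<bar> \<le> K * (y - x)\<^sup>2"
    and q: "\<And>x y. 0 \<le> x \<Longrightarrow> x \<le> y \<Longrightarrow> y < 1 \<Longrightarrow> \<bar>q x - q y\<bar> \<le> L * (y - x)"
    and t: "0 \<le> t" "t < 1"
  shows "(p has_real_derivative - q t) (at t within {0..<1})"
proof -
  have bound: "\<bar>(p y - p t) / (y - t) - - q t\<bar> \<le> (K + L) * \<bar>y - t\<bar>" if y: "0 \<le> y" "y < 1" "y \<noteq> t" for y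
  proof -
    have "L * \<bar>y - t\<bar> \<ge> 0"
      using q[of y t] q[of t y] y t by (cases "y \<le> t") auto
    then have "\<bar>p y - p t + (y - t) * q t\<bar> \<le> (K + L) * \<bar>y - t\<bar> * \<bar>y - t\<bar>"
    proof (cases "t < y")
      case True
      have "\<bar>p y - p t + (y - t) * q t\<bar> \<le> K * (y - t)\<^sup>2"
        using p[of t y] y t True by (simp add: abs_minus_commute algebra_simps)
      also have "\<dots> \<le> K * (y - t)\<^sup>2 + L * \<bar>y - t\<bar> * \<bar>y - t\<bar>"
        using \<open>L * \<bar>y - t\<bar> \<ge> 0\<close> by simp
      finally show ?thesis by (simp add: power2_eq_square algebra_simps abs_mult_self_eq)
    next
      case False
      then have "y < t" using y by simp
      have 1: "\<bar>p y - p t - (t - y) * q y\<bar> \<le> K * (t - y)\<^sup>2"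
        using p[of y t] y t \<open>y < t\<close> by simp
      have "\<bar>(t - y) * (q y - q t)\<bar> = (t - y) * \<bar>q y - q t\<bar>"
        using \<open>y < t\<close> by (simp add: abs_mult)
      also have "\<dots> \<le> (t - y) * (L * (t - y))"
        using q[of y t] y t \<open>y < t\<close> by (intro mult_left_mono) auto
      finally have 2: "\<bar>(t - y) * (q y - q t)\<bar> \<le> (t - y) * (L * (t - y))" .
      have "p y - p t + (y - t) * q t = (p y - p t - (t - y) * q y) + (t - y) * (q y - q t)"
        by (simp add: algebra_simps)
      then have "\<bar>p y - p t + (y - t) * q t\<bar> \<le> K * (t - y)\<^sup>2 + (t - y) * (L * (t - y))"
        using 1 2 by linarith
      also have "\<dots> = (K + L) * \<bar>y - t\<bar> * \<bar>y - t\<bar>"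
        using \<open>y < t\<close> by (simp add: power2_eq_square algebra_simps)
      finally show ?thesis .
    qed
    moreover have "(p y - p t) / (y - t) - - q t = (p y - p t + (y - t) * q t) / (y - t)"
      using y by (simp add: field_simps)
    ultimately show ?thesis
      using y by (simp add: abs_divide pos_divide_le_eq)
  qed
  have "((\<lambda>y. (p y - p t) / (y - t)) \<longlongrightarrow> - q t) (at t within {0..<1})"
  proof (rule LIM_zero_cancel, rule Lim_null_comparison)
    show "\<forall>\<^sub>F y in at t within {0..<1}. norm ((p y - p t) / (y - t) - - q t) \<le> (K + L) * \<bar>y - t\<bar>"
      using bound by (auto simp: eventually_at_filter)
    show "((\<lambda>y. (K + L) * \<bar>y - t\<bar>) \<longlongrightarrow> 0) (at t within {0..<1})"
      by (rule tendsto_eq_intros refl | simp)+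
  qed
  then show ?thesis by (simp add: has_field_derivative_iff)
qed

locale random_flip_leaves = random_flip_graph M V E \<tau> H S c
  for M :: "'w measure" and V :: "'a set" and E \<tau> H S c +
  fixes W :: "'a set" and a b :: nat
  assumes connected: "connected_graph V E" and two_edges: "\<exists>e\<in>E. \<exists>f\<in>E. e \<noteq> f"
    and finite_W: "finite W" and W_subset: "W \<subseteq> V"
    and leaf: "\<forall>v\<in>W. vertex_degree E v = 1" and a_neq_b: "a \<noteq> b"
begin

definition leaf_edge :: "'a \<Rightarrow> 'a set" where
  "leaf_edge v = (THE e. e \<in> E \<and> v \<in> e)"

lemma leaf_edge_unique:
  assumes "v \<in> W" shows "e \<in> E \<and> v \<in> e \<longleftrightarrow> e = leaf_edge v"
proof -
  have "card {e \<in> E. v \<in> e} = 1" using leaf assms by (simp add: vertex_degree_def)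
  then obtain f where "{e \<in> E. v \<in> e} = {f}" by (auto simp: card_1_singleton_iff)
  then have *: "e \<in> E \<and> v \<in> e \<longleftrightarrow> e = f" for e by blast
  then have "leaf_edge v = f" unfolding leaf_edge_def by simp
  with * show ?thesis by simp
qed

lemma leaf_edge: "v \<in> W \<Longrightarrow> leaf_edge v \<in> E" "v \<in> W \<Longrightarrow> v \<in> leaf_edge v"
  using leaf_edge_unique by blast+

text \<open>If two leaves shared their edge, they would be adjacent and form a whole
connected component, so this edge would be the only one of the graph.\<close>

lemma leaf_edge_inj:
  assumes "v \<in> W" "w \<in> W" "v \<noteq> w" shows "leaf_edge v \<noteq> leaf_edge w"
proof
  assume eq: "leaf_edge v = leaf_edge w"
  have "{v, w} \<subseteq> leaf_edge v" using leaf_edge(2) assms eq by auto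
  then have vw: "leaf_edge v = {v, w}"
    using edgeD(2,3)[OF leaf_edge(1)[OF assms(1)]] assms(3)
    by (intro card_subset_eq[symmetric]) auto
  have only: "e = leaf_edge v" if "e \<in> E" "e \<inter> {v, w} \<noteq> {}" for e
    using that leaf_edge_unique[of v e] leaf_edge_unique[of w e] assms eq by auto
  have reach: "x \<in> {v, w}" if "(v, x) \<in> (adj V E)\<^sup>*" for x
    using that
  proof induction
    case (step y z)
    then have "{y, z} = {v, w}" using only[of "{y, z}"] vw by (auto simp: adj_def)
    then show ?case by auto
  qed simp
  have "e = leaf_edge v" if "e \<in> E" for e
  proof (rule only[OF that])
    obtain x where "x \<in> e" using edgeD(3)[OF \<open>e \<in> E\<close>] by fastforce
    moreover have "x \<in> {v, w}"
      using reach connected \<open>x \<in> e\<close> edgeD(1)[OF that] assms(1) W_subset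
      unfolding connected_graph_def by blast
    ultimately show "e \<inter> {v, w} \<noteq> {}" by blast
  qed
  then show False using two_edges by metis
qed

text \<open>The sites whose state in \<open>V - {v}\<close> decides whether the ringing of the edge at
\<open>v\<close> is the first event that changes a site of \<open>W\<close>.\<close>

definition near :: "'a \<Rightarrow> 'a set" where
  "near v = (W \<union> nbhd 1 v V E) - {v}"

lemma nbhd_leaf:
  assumes "v \<in> W" shows "nbhd 1 v V E = leaf_edge v"
proof -
  have vV: "v \<in> V" using assms W_subset by blast
  have "w \<in> nbhd 1 v V E \<longleftrightarrow> w \<in> leaf_edge v" for w
  proof -
    have "w \<in> nbhd 1 v V E \<longleftrightarrow> w \<in> V \<and> (w = v \<or> (v, w) \<in> adj V E)"
      unfolding nbhd_def by (auto simp: le_Suc_eq)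
    also have "\<dots> \<longleftrightarrow> w = v \<or> w \<in> V \<and> {v, w} = leaf_edge v"
      using vV leaf_edge_unique[OF assms, of "{v, w}"] by (auto simp: adj_def)
    also have "\<dots> \<longleftrightarrow> w \<in> leaf_edge v"
    proof
      assume w: "w \<in> leaf_edge v"
      show "w = v \<or> w \<in> V \<and> {v, w} = leaf_edge v"
      proof (cases "w = v")
        case False
        then have "{v, w} = leaf_edge v"
          using w leaf_edge[OF assms] edgeD(2,3)[of "leaf_edge v"]
          by (intro card_subset_eq) auto
        then show ?thesis using w edgeD(1) leaf_edge(1)[OF assms] by blast
      qed simp
    qed (use leaf_edge(2)[OF assms] in auto)
    finally show ?thesis .
  qed
  then show ?thesis by blast
qed

lemma near_eq: "v \<in> W \<Longrightarrow> near v = (W \<union> leaf_edge v) - {v}"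
  by (simp only: near_def nbhd_leaf)

text \<open>Outside of the rings of these finitely many edges, neither the leaves in \<open>W\<close>
nor their neighbours change.\<close>

definition near_edges :: "'a set set" where
  "near_edges = {e \<in> E. e \<inter> (W \<union> \<Union>(leaf_edge ` W)) \<noteq> {}}"

lemma near_subset: "v \<in> W \<Longrightarrow> near v \<subseteq> V - {v}"
  using near_eq[of v] W_subset edgeD(1)[OF leaf_edge(1)] by auto

lemma finite_near: "v \<in> W \<Longrightarrow> finite (near v)"
  using near_eq[of v] finite_W edgeD(2)[OF leaf_edge(1)] by auto

lemma near_edges: "near_edges \<subseteq> E" "finite near_edges"
    "v \<in> W \<Longrightarrow> leaf_edge v \<in> near_edges"
    "v \<in> W \<Longrightarrow> e \<in> E \<Longrightarrow> w \<in> e \<Longrightarrow> w \<in> near v \<Longrightarrow> e \<in> near_edges"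
    "v \<in> W \<Longrightarrow> e \<in> E \<Longrightarrow> w \<in> e \<Longrightarrow> w \<in> leaf_edge v \<Longrightarrow> e \<in> near_edges"
proof -
  let ?U = "W \<union> \<Union>(leaf_edge ` W)"
  have U: "finite ?U" using finite_W edgeD(2) leaf_edge(1) by auto
  have UV: "u \<in> V" if "u \<in> ?U" for u
    using that W_subset edgeD(1) leaf_edge(1) by blast
  have "near_edges = (\<Union>u\<in>?U. {e \<in> E. u \<in> e})" unfolding near_edges_def by auto
  then show "finite near_edges" by (simp only:) (intro finite_UN_I U finite_incident UV)
  show "near_edges \<subseteq> E" by (auto simp: near_edges_def)
  show "v \<in> W \<Longrightarrow> leaf_edge v \<in> near_edges"
    using leaf_edge[of v] by (auto simp: near_edges_def)
  show "v \<in> W \<Longrightarrow> e \<in> E \<Longrightarrow> w \<in> e \<Longrightarrow> w \<in> near v \<Longrightarrow> e \<in> near_edges"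
    using near_eq[of v] by (auto simp: near_edges_def)
  show "v \<in> W \<Longrightarrow> e \<in> E \<Longrightarrow> w \<in> e \<Longrightarrow> w \<in> leaf_edge v \<Longrightarrow> e \<in> near_edges"
    by (auto simp: near_edges_def)
qed

abbreviation X :: "'a set \<Rightarrow> real \<Rightarrow> 'a \<Rightarrow> 'w \<Rightarrow> nat" where
  "X V' t v \<omega> \<equiv> flip_process E (\<lambda>e. \<tau> e \<omega>) (H \<omega>) a b V' t v"

abbreviation Flip :: "'a set \<Rightarrow> real \<Rightarrow> 'a \<Rightarrow> 'w \<Rightarrow> bool" where
  "Flip V' t v \<omega> \<equiv> flipped (induced_edges E V') (\<lambda>e. \<tau> e \<omega>) (H \<omega>) t v"

text \<open>The realisations in which the states are given by \<open>flipped\<close>, in every volume.\<close>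

definition regular :: "'w \<Rightarrow> bool" where
  "regular \<omega> \<longleftrightarrow> \<omega> \<in> space M \<and> wf (attacks E (\<lambda>e. \<tau> e \<omega>) (H \<omega>))"

lemma AE_regular: "AE \<omega> in M. regular \<omega>"
  using AE_wf_attacks AE_space by eventually_elim (simp add: regular_def)

lemma induced_V: "induced_edges E V = E"
  using edgeD(1) by (auto simp: induced_edges_def)

lemma regular_wf:
  assumes "regular \<omega>"
  shows "wf (attacks (induced_edges E V') (\<lambda>e. \<tau> e \<omega>) (H \<omega>))"
proof (rule wf_subset)
  show "wf (attacks E (\<lambda>e. \<tau> e \<omega>) (H \<omega>))" using assms by (simp add: regular_def)
qed (auto intro!: attacks_mono simp: induced_edges_def)

lemma X_iff_not_Flip:
  assumes "regular \<omega>" "V' \<subseteq> V" "v \<in> V'"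
  shows "X V' t v \<omega> = a \<longleftrightarrow> \<not> Flip V' t v \<omega>"
proof -
  have "X V' t v \<omega> = (if Flip V' t v \<omega> then b else a)"
  proof (rule flip_process_eq[OF regular_wf[OF assms(1)]])
    show "countable V'" using assms(2) countable_V countable_subset by blast
    show "finite {e \<in> E. v \<in> e}" if "v \<in> V'" for v
      using that assms(2) finite_incident by blast
    show "v \<in> e" if "e \<in> E" "H \<omega> e v" for e v
      using that assms(1) hit_endpoint by (auto simp: regular_def)
  qed (use assms edgeD a_neq_b in auto)
  then show ?thesis using a_neq_b by simp
qed

lemma X_leaf_iff:
  assumes "regular \<omega>" "v \<in> W" shows "X V t v \<omega> = a \<longleftrightarrow> \<not> Flip V t v \<omega>"
  using X_iff_not_Flip[OF assms(1) order_refl] assms(2) W_subset by blast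

lemma X_near_iff:
  assumes "regular \<omega>" "v \<in> W" "w \<in> near v"
  shows "X (V - {v}) t w \<omega> = a \<longleftrightarrow> \<not> Flip (V - {v}) t w \<omega>"
  using X_iff_not_Flip[OF assms(1), of "V - {v}"] near_subset[OF assms(2)] assms(3) by blast

lemma Flip_mono: "s \<le> s' \<Longrightarrow> Flip V' s v \<omega> \<Longrightarrow> Flip V' s' v \<omega>"
  by (force simp: flipped_def)

lemma Flip_later:
  assumes "regular \<omega>" "Flip V' s' v \<omega>" "\<not> Flip V' s v \<omega>"
  obtains e where "e \<in> E" "v \<in> e" "\<tau> e \<omega> \<in> {s<..s'}"
  using assms hit_endpoint[of \<omega>]
  by (force simp: flipped_def regular_def induced_edges_def)

lemma Flip_leaf:
  assumes "regular \<omega>" "v \<in> W"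
  shows "Flip V s v \<omega> \<longleftrightarrow> \<tau> (leaf_edge v) \<omega> \<le> s \<and> H \<omega> (leaf_edge v) v \<and>
    effective E (\<lambda>e. \<tau> e \<omega>) (H \<omega>) (leaf_edge v)"
proof -
  have "e = leaf_edge v" if "e \<in> E" "H \<omega> e v" for e
    using hit_endpoint[of \<omega> e v] that assms leaf_edge_unique by (auto simp: regular_def)
  then show ?thesis using leaf_edge[OF assms(2)] unfolding flipped_def induced_V by blast
qed

text \<open>Before its only edge rings, a leaf does not influence the other sites.\<close>

lemma Flip_remove_leaf:
  assumes "regular \<omega>" "v \<in> W" "s < \<tau> (leaf_edge v) \<omega>"
  shows "Flip V s w \<omega> \<longleftrightarrow> Flip (V - {v}) s w \<omega>"
proof (rule flipped_remove_leaf[OF regular_wf[OF assms(1)]])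
  fix e assume "e \<in> E" "v \<in> e"
  then show "s < \<tau> e \<omega>" using leaf_edge_unique[OF assms(2), of e] assms(3) by simp
qed

text \<open>The edge at the leaf \<open>v\<close> rings during \<open>{s<..s'}\<close> and meets, at time \<open>s\<close>, the
favourable configuration of the process without \<open>v\<close>. The clock and the hit
are independent of that configuration, which gives the terms of the sum in the
derivative.\<close>

definition leaf_attack :: "real \<Rightarrow> real \<Rightarrow> 'a \<Rightarrow> 'w set" where
  "leaf_attack s s' v = {\<omega> \<in> space M. \<tau> (leaf_edge v) \<omega> \<in> {s<..s'} \<and> H \<omega> (leaf_edge v) v \<and>
     (\<forall>w\<in>near v. X (V - {v}) s w \<omega> = a)}"

text \<open>The event whose probability is the decrease of \<open>leaf_prob\<close> from \<open>s\<close> to \<open>s'\<close>.\<close>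

definition first_flip :: "real \<Rightarrow> real \<Rightarrow> 'w set" where
  "first_flip s s' = {\<omega> \<in> space M. (\<forall>v\<in>W. X V s v \<omega> = a) \<and> \<not> (\<forall>v\<in>W. X V s' v \<omega> = a)}"

text \<open>The exceptional event, of probability of order \<open>(s' - s)\<^sup>2\<close>, outside of which
\<open>first_flip\<close> is almost surely the disjoint union of the events \<open>leaf_attack\<close>.\<close>

definition two_rings :: "real \<Rightarrow> real \<Rightarrow> 'w set" where
  "two_rings s s' = (\<Union>(e, f)\<in>{(e, f). e \<in> near_edges \<and> f \<in> near_edges \<and> e \<noteq> f}.
     {\<omega> \<in> space M. \<tau> e \<omega> \<in> {s<..s'}} \<inter> {\<omega> \<in> space M. \<tau> f \<omega> \<in> {s<..s'}})"

lemma two_ringsI: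
  "\<omega> \<in> space M \<Longrightarrow> e \<in> near_edges \<Longrightarrow> f \<in> near_edges \<Longrightarrow> e \<noteq> f \<Longrightarrow>
     \<tau> e \<omega> \<in> {s<..s'} \<Longrightarrow> \<tau> f \<omega> \<in> {s<..s'} \<Longrightarrow> \<omega> \<in> two_rings s s'"
  unfolding two_rings_def by blast

text \<open>A leaf changes only when its edge \<open>e\<close> acts. If \<open>e\<close> does so after time \<open>s\<close>, the
other endpoint has not changed by time \<open>s\<close>, as the edge changing it would be an
effective attacker of \<open>e\<close>. Up to time \<open>s\<close> the process does not notice that \<open>v\<close>
is present.\<close>

lemma first_flip_imp_leaf_attack:
  assumes reg: "regular \<omega>" and \<omega>: "\<omega> \<in> first_flip s s'"
  shows "\<exists>v\<in>W. \<omega> \<in> leaf_attack s s' v"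
proof -
  have vac: "\<not> Flip V s w \<omega>" if "w \<in> W" for w
    using \<omega> that X_leaf_iff[OF reg that, of s] unfolding first_flip_def by blast
  obtain v where v: "v \<in> W" "Flip V s' v \<omega>"
    using \<omega> X_leaf_iff[OF reg] by (auto simp: first_flip_def)
  let ?e = "leaf_edge v"
  have e: "\<tau> ?e \<omega> \<le> s'" "H \<omega> ?e v" "effective E (\<lambda>e. \<tau> e \<omega>) (H \<omega>) ?e"
    using v Flip_leaf[OF reg v(1)] by auto
  then have s: "s < \<tau> ?e \<omega>" using vac[OF v(1)] Flip_leaf[OF reg v(1)] by auto
  have wf: "wf (attacks E (\<lambda>e. \<tau> e \<omega>) (H \<omega>))" using reg by (simp add: regular_def)
  have "\<not> Flip V s w \<omega>" if "w \<in> near v" for w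
  proof (cases "w \<in> W")
    case False
    then have w: "w \<in> ?e" using that near_eq[OF v(1)] by auto
    show ?thesis
    proof
      assume "Flip V s w \<omega>"
      then obtain f where "f \<in> E" "\<tau> f \<omega> \<le> s" "H \<omega> f w" "effective E (\<lambda>e. \<tau> e \<omega>) (H \<omega>) f"
        unfolding flipped_def induced_V by blast
      moreover from this have "(f, ?e) \<in> attacks E (\<lambda>e. \<tau> e \<omega>) (H \<omega>)"
        using s w leaf_edge(1)[OF v(1)] by (auto simp: attacks_def)
      ultimately show False using effective_iff[OF wf, of ?e] e(3) by blast
    qed
  qed (rule vac)
  then have "\<forall>w\<in>near v. X (V - {v}) s w \<omega> = a"
    using Flip_remove_leaf[OF reg v(1) s] X_near_iff[OF reg v(1)] by simp
  then show ?thesis using v e s reg by (auto simp: leaf_attack_def regular_def)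
qed

text \<open>The favourable configuration at time \<open>s\<close> might be destroyed before the edge at
\<open>v\<close> rings. This requires a second ringing edge nearby, which is excluded
outside of \<open>two_rings\<close>.\<close>

lemma leaf_attack_imp_first_flip:
  assumes reg: "regular \<omega>" and v: "v \<in> W"
    and \<omega>: "\<omega> \<in> leaf_attack s s' v" "\<omega> \<notin> two_rings s s'"
  shows "\<omega> \<in> first_flip s s'"
proof -
  let ?e = "leaf_edge v"
  have sp: "\<omega> \<in> space M" and wf: "wf (attacks E (\<lambda>e. \<tau> e \<omega>) (H \<omega>))"
    using reg by (auto simp: regular_def)
  have s: "s < \<tau> ?e \<omega>" "\<tau> ?e \<omega> \<le> s'" and hit: "H \<omega> ?e v"
    and vac': "\<forall>w\<in>near v. X (V - {v}) s w \<omega> = a"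
    using \<omega>(1) by (auto simp: leaf_attack_def)
  have vac: "\<not> Flip V s w \<omega>" if "w \<in> near v" for w
    using vac' Flip_remove_leaf[OF reg v s(1), of w] X_near_iff[OF reg v that, of s] that by blast
  have vac_v: "\<not> Flip V s v \<omega>" using Flip_leaf[OF reg v] s by simp
  have "\<not> effective E (\<lambda>e. \<tau> e \<omega>) (H \<omega>) f" if f: "(f, ?e) \<in> attacks E (\<lambda>e. \<tau> e \<omega>) (H \<omega>)" for f
  proof
    assume eff: "effective E (\<lambda>e. \<tau> e \<omega>) (H \<omega>) f"
    obtain u where u: "f \<in> E" "\<tau> f \<omega> < \<tau> ?e \<omega>" "u \<in> ?e" "H \<omega> f u"
      using f by (auto simp: attacks_def)
    have "u \<in> f" using hit_endpoint[OF sp u(1,4)] .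
    then have "f \<in> near_edges" using near_edges(5)[OF v u(1)] u(3) by blast
    moreover have "f \<noteq> ?e" using u(2) by auto
    ultimately have "\<tau> f \<omega> \<le> s"
      using two_ringsI[OF sp, of f ?e s s'] near_edges(3)[OF v] s \<omega>(2) u(2) by force
    then have "Flip V s u \<omega>" unfolding flipped_def induced_V using u eff by blast
    then show False using vac vac_v u(3) near_eq[OF v] by (cases "u = v") auto
  qed
  then have "effective E (\<lambda>e. \<tau> e \<omega>) (H \<omega>) ?e" using effective_iff[OF wf, of ?e] by blast
  then have "Flip V s' v \<omega>" using Flip_leaf[OF reg v] s hit by blast
  then have "\<not> (\<forall>v\<in>W. X V s' v \<omega> = a)"
    using X_leaf_iff[OF reg v] v by blast
  moreover have "X V s w \<omega> = a" if "w \<in> W" for w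
    using vac[of w] vac_v that near_eq[OF v] X_leaf_iff[OF reg that] by (cases "w = v") auto
  ultimately show ?thesis using sp by (auto simp: first_flip_def)
qed

lemma leaf_attack_disjoint:
  assumes "v \<in> W" "w \<in> W" "v \<noteq> w" "\<omega> \<in> leaf_attack s s' v" "\<omega> \<in> leaf_attack s s' w"
  shows "\<omega> \<in> two_rings s s'"
  using assms leaf_edge_inj near_edges(3)
  by (intro two_ringsI[of \<omega> "leaf_edge v" "leaf_edge w"]) (auto simp: leaf_attack_def)

lemma X_measurable:
  assumes "V' \<subseteq> V" "induced_edges E V' \<subseteq> D" "D \<subseteq> E" "finite A"
  shows "Measurable.pred (edge_algebra D) (\<lambda>\<omega>. \<forall>v\<in>A. X V' t v \<omega> = a)"
  using flip_process_measurable[OF assms(1-3) a_neq_b] assms(4) by (intro pred_intros_finite)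

lemma leaves_event: "{\<omega> \<in> space M. \<forall>v\<in>W. X V t v \<omega> = a} \<in> events"
  by (rule pred_edge_algebra_events[OF order_refl X_measurable])
    (use finite_W in \<open>auto simp: induced_V\<close>)

lemma near_event:
  assumes "v \<in> W"
  shows "{\<omega> \<in> space M. \<forall>w\<in>near v. X (V - {v}) t w \<omega> = a} \<in> events"
  by (rule pred_edge_algebra_events[OF order_refl X_measurable])
    (use finite_near[OF assms] in \<open>auto simp: induced_edges_def\<close>)

lemma ring_event: "e \<in> E \<Longrightarrow> {\<omega> \<in> space M. \<tau> e \<omega> \<in> {s<..s'}} \<in> events"
  by (rule clock_events) auto

definition leaf_prob :: "real \<Rightarrow> real" where
  "leaf_prob t = prob {\<omega> \<in> space M. \<forall>v\<in>W. X V t v \<omega> = a}"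

definition near_prob :: "'a \<Rightarrow> real \<Rightarrow> real" where
  "near_prob v t = prob {\<omega> \<in> space M. \<forall>w\<in>near v. X (V - {v}) t w \<omega> = a}"

text \<open>The configuration of the process on \<open>V - {v}\<close> depends on the edges that avoid
\<open>v\<close>, so it is independent of the clock and the hit of the edge at \<open>v\<close>.\<close>

lemma leaf_attack_event_prob:
  assumes v: "v \<in> W" and s: "0 \<le> s" "s \<le> s'" "s' < 1"
  shows "leaf_attack s s' v \<in> events"
    "prob (leaf_attack s s' v) = c * (s' - s) * near_prob v s"
proof -
  let ?e = "leaf_edge v"
  let ?A = "{\<omega> \<in> space M. \<forall>w\<in>near v. X (V - {v}) s w \<omega> = a}"
  let ?B = "{\<omega> \<in> space M. \<tau> ?e \<omega> \<in> {s<..s'} \<and> H \<omega> ?e v}"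
  let ?D = "induced_edges E (V - {v})"
  have D: "?D \<subseteq> E" "?e \<notin> ?D" and e: "?e \<in> E" "{?e} \<subseteq> E"
    using leaf_edge[OF v] by (auto simp: induced_edges_def)
  have eq: "leaf_attack s s' v = ?A \<inter> ?B" by (auto simp: leaf_attack_def)
  have A: "?A \<in> sets (edge_algebra ?D)"
    using X_measurable[of "V - {v}" ?D "near v"] D finite_near[OF v] by (auto simp: pred_def)
  have [measurable]: "\<tau> ?e \<in> borel_measurable (edge_algebra {?e})"
    "Measurable.pred (edge_algebra {?e}) (\<lambda>\<omega>. H \<omega> ?e v)"
    using clock_measurable[OF e(2)] hit_measurable[OF e(2)] by auto
  have "Measurable.pred (edge_algebra {?e}) (\<lambda>\<omega>. \<tau> ?e \<omega> \<in> {s<..s'} \<and> H \<omega> ?e v)"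
    by measurable
  then have B: "?B \<in> sets (edge_algebra {?e})" by (simp add: pred_def)
  have "{0<..<1} \<inter> {s<..s'} = {s<..s'}" using s by auto
  then have "prob ?B = c * (s' - s)"
    using hit_prob[OF e(1) leaf_edge(2)[OF v], of "{s<..s'}"] s by simp
  then show "prob (leaf_attack s s' v) = c * (s' - s) * near_prob v s"
    unfolding eq prob_edge_algebra_indep[OF D(1) e(1) D(2) A B] near_prob_def by simp
  show "leaf_attack s s' v \<in> events"
    unfolding eq using A B edge_algebra_events[OF D(1)] edge_algebra_events[OF e(2)] by blast
qed

lemma two_rings_event_prob:
  assumes s: "0 \<le> s" "s \<le> s'" "s' < 1"
  shows "two_rings s s' \<in> events"
    "prob (two_rings s s') \<le> (real (card near_edges))\<^sup>2 * (s' - s)\<^sup>2"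
proof -
  let ?P = "{(e, f). e \<in> near_edges \<and> f \<in> near_edges \<and> e \<noteq> f}"
  let ?R = "\<lambda>e. {\<omega> \<in> space M. \<tau> e \<omega> \<in> {s<..s'}}"
  have sub: "?P \<subseteq> near_edges \<times> near_edges" by auto
  have fin: "finite ?P" by (rule finite_subset[OF sub]) (simp add: near_edges(2))
  have card: "real (card ?P) \<le> (real (card near_edges))\<^sup>2"
    using card_mono[OF _ sub] near_edges(2)
    by (simp add: card_cartesian_product power2_eq_square flip: of_nat_mult)
  have R: "?R e \<inter> ?R f \<in> events" "prob (?R e \<inter> ?R f) = (s' - s)\<^sup>2" if "(e, f) \<in> ?P" for e f
  proof -
    have E: "e \<in> E" "f \<in> E" "e \<noteq> f" using that near_edges(1) by auto
    show "?R e \<inter> ?R f \<in> events" using ring_event E by blast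
    have "prob (\<Inter>g\<in>{e, f}. ?R g) = (\<Prod>g\<in>{e, f}. prob (?R g))"
      by (rule indep_setsD[OF indep]) (use E clock_sets[of _ "{s<..s'}"] in auto)
    also have "\<dots> = (s' - s)\<^sup>2"
      using E prob_clock_Ioc[OF _ s] by (simp add: power2_eq_square)
    finally show "prob (?R e \<inter> ?R f) = (s' - s)\<^sup>2" by simp
  qed
  have eq: "two_rings s s' = (\<Union>p\<in>?P. ?R (fst p) \<inter> ?R (snd p))"
    unfolding two_rings_def by (simp add: case_prod_unfold)
  have ev: "?R (fst p) \<inter> ?R (snd p) \<in> events" if "p \<in> ?P" for p
    using R(1)[of "fst p" "snd p"] that by simp
  show "two_rings s s' \<in> events"
    unfolding eq using fin ev by (rule sets.finite_UN)
  have "prob (two_rings s s') \<le> (\<Sum>p\<in>?P. prob (?R (fst p) \<inter> ?R (snd p)))"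
    unfolding eq using fin ev by (intro finite_measure_subadditive_finite) auto
  also have "\<dots> = (\<Sum>p\<in>?P. (s' - s)\<^sup>2)"
  proof (rule sum.cong[OF refl])
    fix p assume "p \<in> ?P"
    then show "prob (?R (fst p) \<inter> ?R (snd p)) = (s' - s)\<^sup>2"
      by (intro R(2)) simp
  qed
  also have "\<dots> \<le> (real (card near_edges))\<^sup>2 * (s' - s)\<^sup>2"
    using card by (simp add: mult_right_mono)
  finally show "prob (two_rings s s') \<le> (real (card near_edges))\<^sup>2 * (s' - s)\<^sup>2" .
qed

lemma first_flip_event: "first_flip s s' \<in> events"
proof -
  have "first_flip s s' = {\<omega> \<in> space M. \<forall>v\<in>W. X V s v \<omega> = a} - {\<omega> \<in> space M. \<forall>v\<in>W. X V s' v \<omega> = a}"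
    by (auto simp: first_flip_def)
  then show ?thesis using leaves_event by (simp add: sets.Diff)
qed

lemma leaf_prob_diff:
  assumes "s \<le> s'"
  shows "leaf_prob s - leaf_prob s' = prob (first_flip s s')"
proof -
  let ?B = "\<lambda>s. {\<omega> \<in> space M. \<forall>v\<in>W. X V s v \<omega> = a}"
  have "AE \<omega> in M. \<omega> \<in> ?B s' \<longleftrightarrow> \<omega> \<in> ?B s - first_flip s s'"
    using AE_regular
  proof eventually_elim
    case (elim \<omega>)
    have "X V s v \<omega> = a" if "X V s' v \<omega> = a" "v \<in> W" for v
      using that X_leaf_iff[OF elim that(2)] Flip_mono[OF assms, where V' = V and v = v and \<omega> = \<omega>] by blast
    then show ?case by (auto simp: first_flip_def)
  qed
  then have "prob (?B s') = prob (?B s - first_flip s s')"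
    by (rule finite_measure_eq_AE) (use leaves_event first_flip_event in auto)
  also have "\<dots> = prob (?B s) - prob (first_flip s s')"
    by (rule finite_measure_Diff[OF leaves_event first_flip_event]) (auto simp: first_flip_def)
  finally show ?thesis by (simp add: leaf_prob_def)
qed

text \<open>The events \<open>leaf_attack\<close> cover \<open>first_flip\<close>, which bounds its probability by
their sum. After removal of \<open>two_rings\<close> they become disjoint subsets of
\<open>first_flip\<close>, which gives the bound in the other direction up to \<open>card W\<close>
times the probability of \<open>two_rings\<close>.\<close>

lemma leaf_prob_increment:
  assumes s: "0 \<le> s" "s \<le> s'" "s' < 1"
  shows "\<bar>leaf_prob s - leaf_prob s' - (s' - s) * (c * (\<Sum>v\<in>W. near_prob v s))\<bar>
    \<le> real (card W) * (real (card near_edges))\<^sup>2 * (s' - s)\<^sup>2"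
proof -
  let ?Q = "first_flip s s'" and ?C = "leaf_attack s s'" and ?D = "two_rings s s'"
  note C = leaf_attack_event_prob[OF _ s] and D = two_rings_event_prob[OF s]
  have sum_C: "(\<Sum>v\<in>W. prob (?C v)) = (s' - s) * (c * (\<Sum>v\<in>W. near_prob v s))"
    by (simp add: C(2) sum_distrib_left algebra_simps)
  have "prob ?Q \<le> prob (\<Union>v\<in>W. ?C v)"
  proof (rule finite_measure_mono_AE)
    show "AE \<omega> in M. \<omega> \<in> ?Q \<longrightarrow> \<omega> \<in> (\<Union>v\<in>W. ?C v)"
      using AE_regular by eventually_elim (use first_flip_imp_leaf_attack in blast)
  qed (use C(1) finite_W in auto)
  also have "\<dots> \<le> (\<Sum>v\<in>W. prob (?C v))"
    using finite_W C(1) by (intro finite_measure_subadditive_finite) auto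
  finally have upper: "prob ?Q \<le> (\<Sum>v\<in>W. prob (?C v))" .
  have "(\<Sum>v\<in>W. prob (?C v)) \<le> (\<Sum>v\<in>W. prob (?C v - ?D) + prob ?D)"
  proof (rule sum_mono)
    fix v assume v: "v \<in> W"
    have "prob (?C v) \<le> prob ((?C v - ?D) \<union> ?D)"
      using C(1)[OF v] D(1) by (intro finite_measure_mono) auto
    also have "\<dots> \<le> prob (?C v - ?D) + prob ?D"
      using C(1)[OF v] D(1) by (intro measure_Un_le) auto
    finally show "prob (?C v) \<le> prob (?C v - ?D) + prob ?D" .
  qed
  also have "\<dots> = prob (\<Union>v\<in>W. ?C v - ?D) + real (card W) * prob ?D"
  proof -
    have "disjoint_family_on (\<lambda>v. ?C v - ?D) W"
      using leaf_attack_disjoint by (fastforce simp: disjoint_family_on_def)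
    then have "prob (\<Union>v\<in>W. ?C v - ?D) = (\<Sum>v\<in>W. prob (?C v - ?D))"
      using finite_W C(1) D(1) by (intro finite_measure_finite_Union) auto
    then show ?thesis by (simp add: sum.distrib)
  qed
  also have "prob (\<Union>v\<in>W. ?C v - ?D) \<le> prob ?Q"
  proof (rule finite_measure_mono_AE[OF _ first_flip_event])
    show "AE \<omega> in M. \<omega> \<in> (\<Union>v\<in>W. ?C v - ?D) \<longrightarrow> \<omega> \<in> ?Q"
      using AE_regular by eventually_elim (use leaf_attack_imp_first_flip in blast)
  qed
  finally have lower: "(\<Sum>v\<in>W. prob (?C v)) \<le> prob ?Q + real (card W) * prob ?D" by simp
  have "real (card W) * prob ?D \<le> real (card W) * ((real (card near_edges))\<^sup>2 * (s' - s)\<^sup>2)"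
    using D(2) by (rule mult_left_mono) simp
  then show ?thesis
    using upper lower leaf_prob_diff[OF s(2)] unfolding sum_C by (simp add: mult.assoc)
qed

text \<open>A site changes during \<open>{s<..s'}\<close> only if one of its edges rings then.\<close>

lemma near_prob_Lipschitz:
  assumes v: "v \<in> W" and s: "0 \<le> s" "s \<le> s'" "s' < 1"
  shows "\<bar>near_prob v s - near_prob v s'\<bar> \<le> real (card near_edges) * (s' - s)"
proof -
  let ?A = "\<lambda>s. {\<omega> \<in> space M. \<forall>w\<in>near v. X (V - {v}) s w \<omega> = a}"
  let ?R = "\<lambda>e. {\<omega> \<in> space M. \<tau> e \<omega> \<in> {s<..s'}}"
  have R: "?R e \<in> events" if "e \<in> near_edges" for e
    using that near_edges(1) ring_event by blast
  have "prob (?A s') \<le> prob (?A s)"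
  proof (rule finite_measure_mono_AE[OF _ near_event[OF v]])
    show "AE \<omega> in M. \<omega> \<in> ?A s' \<longrightarrow> \<omega> \<in> ?A s"
      using AE_regular by eventually_elim (use X_near_iff[OF _ v] Flip_mono[OF s(2)] in simp, blast)
  qed
  moreover have "prob (?A s) \<le> prob (?A s') + real (card near_edges) * (s' - s)"
  proof -
    have "prob (?A s) \<le> prob (?A s' \<union> (\<Union>e\<in>near_edges. ?R e))"
    proof (rule finite_measure_mono_AE)
      show "AE \<omega> in M. \<omega> \<in> ?A s \<longrightarrow> \<omega> \<in> ?A s' \<union> (\<Union>e\<in>near_edges. ?R e)"
        using AE_regular
      proof eventually_elim
        case (elim \<omega>)
        show ?case
        proof (intro impI UnCI)
          assume A: "\<omega> \<in> ?A s" and no: "\<omega> \<notin> (\<Union>e\<in>near_edges. ?R e)"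
          have "\<not> Flip (V - {v}) s' w \<omega>" if w: "w \<in> near v" for w
          proof
            assume F: "Flip (V - {v}) s' w \<omega>"
            have "\<not> Flip (V - {v}) s w \<omega>" using A X_near_iff[OF elim v w, of s] w by blast
            then obtain e where "e \<in> E" "w \<in> e" "\<tau> e \<omega> \<in> {s<..s'}"
              using Flip_later[OF elim F] by blast
            then show False using no near_edges(4)[OF v _ _ w] A by blast
          qed
          then show "\<omega> \<in> ?A s'" using A X_near_iff[OF elim v] by simp
        qed
      qed
      show "?A s' \<union> (\<Union>e\<in>near_edges. ?R e) \<in> events"
        using near_event[OF v] R near_edges(2) by (intro sets.Un sets.finite_UN) auto
    qed
    also have "\<dots> \<le> prob (?A s') + prob (\<Union>e\<in>near_edges. ?R e)"
      using near_event[OF v] R near_edges(2)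
      by (intro measure_Un_le sets.finite_UN) auto
    also have "prob (\<Union>e\<in>near_edges. ?R e) \<le> (\<Sum>e\<in>near_edges. prob (?R e))"
      using R near_edges(2) by (intro finite_measure_subadditive_finite) auto
    also have "\<dots> = (\<Sum>e\<in>near_edges. s' - s)"
      using prob_clock_Ioc[OF _ s] near_edges(1) by (intro sum.cong) auto
    finally show ?thesis by simp
  qed
  ultimately show ?thesis by (simp add: near_prob_def)
qed

lemma leaf_prob_derivative:
  assumes "0 \<le> t" "t < 1"
  shows "(leaf_prob has_real_derivative - (c * (\<Sum>v\<in>W. near_prob v t))) (at t within {0..<1})"
proof (rule has_derivative_from_quadratic_error[OF _ _ assms])
  show "\<bar>leaf_prob x - leaf_prob y - (y - x) * (c * (\<Sum>v\<in>W. near_prob v x))\<bar>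
      \<le> (real (card W) * (real (card near_edges))\<^sup>2) * (y - x)\<^sup>2"
    if "0 \<le> x" "x \<le> y" "y < 1" for x y
    by (rule leaf_prob_increment[OF that])
  show "\<bar>c * (\<Sum>v\<in>W. near_prob v x) - c * (\<Sum>v\<in>W. near_prob v y)\<bar>
      \<le> (\<bar>c\<bar> * (real (card W) * real (card near_edges))) * (y - x)"
    if "0 \<le> x" "x \<le> y" "y < 1" for x y
  proof -
    have "\<bar>c * (\<Sum>v\<in>W. near_prob v x) - c * (\<Sum>v\<in>W. near_prob v y)\<bar>
        = \<bar>c\<bar> * \<bar>\<Sum>v\<in>W. near_prob v x - near_prob v y\<bar>"
      by (simp add: sum_subtractf abs_mult flip: right_diff_distrib)
    also have "\<dots> \<le> \<bar>c\<bar> * (\<Sum>v\<in>W. real (card near_edges) * (y - x))"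
      using near_prob_Lipschitz[OF _ that]
      by (intro mult_left_mono order_trans[OF sum_abs] sum_mono) auto
    finally show ?thesis by (simp add: mult.assoc)
  qed
qed

end

section \<open>Dimer RSA and the annihilation process\<close>

lemma measure_uniform_unit:
  "B \<in> sets borel \<Longrightarrow> measure (uniform_measure lborel {0<..<1::real}) B = measure lborel ({0<..<1} \<inter> B)"
  by (subst measure_uniform_measure) auto

lemma Int_stable_vimages: "Int_stable {X -` A \<inter> space M | A. A \<in> sets N}"
proof (rule Int_stableI, clarify)
  fix A B assume "A \<in> sets N" "B \<in> sets N"
  then show "\<exists>C. (X -` A \<inter> space M) \<inter> (X -` B \<inter> space M) = X -` C \<inter> space M \<and> C \<in> sets N"
    by (intro exI[of _ "A \<inter> B"]) auto
qed

lemma dimer_random_flip_graph: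
  assumes "prob_space M" "simple_graph V E" "countable V" "bounded_degree V E" "iid_clocks M E \<tau>"
  shows "random_flip_graph M V E \<tau> (\<lambda>\<omega> e v. v \<in> e)
           (\<lambda>e. {\<tau> e -` A \<inter> space M | A. A \<in> sets borel}) 1"
proof -
  interpret prob_space M by fact
  have indep: "indep_vars (\<lambda>_. borel) \<tau> E"
    and law: "\<And>e. e \<in> E \<Longrightarrow> distr M borel (\<tau> e) = uniform_measure lborel {0<..<1}"
    using assms(5) by (auto simp: iid_clocks_def)
  have meas: "\<tau> e \<in> borel_measurable M" if "e \<in> E" for e
    using indep that by (auto simp: indep_vars_def2)
  have uniform: "prob {\<omega> \<in> space M. \<tau> e \<omega> \<in> B} = measure lborel ({0<..<1} \<inter> B)"
    if "e \<in> E" "B \<in> sets borel" for e B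
  proof -
    have "prob {\<omega> \<in> space M. \<tau> e \<omega> \<in> B} = measure (distr M borel (\<tau> e)) B"
      using meas that by (subst measure_distr) (auto simp: vimage_def Int_def conj_commute)
    then show ?thesis using law[OF that(1)] measure_uniform_unit[OF that(2)] by simp
  qed
  show ?thesis
  proof
    fix e v and B :: "real set"
    show "indep_sets (\<lambda>e. {\<tau> e -` A \<inter> space M | A. A \<in> sets borel}) E"
      using indep by (simp add: indep_vars_def2)
    show "Int_stable {\<tau> e -` A \<inter> space M | A. A \<in> sets borel}" by (rule Int_stable_vimages)
    show "{\<omega> \<in> space M. \<tau> e \<omega> \<in> B} \<in> {\<tau> e -` A \<inter> space M | A. A \<in> sets borel}"
      if "B \<in> sets borel"
      using that by (intro CollectI exI[of _ B]) auto
    show "{\<omega> \<in> space M. v \<in> e} \<in> {\<tau> e -` A \<inter> space M | A. A \<in> sets borel}"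
      by (intro CollectI exI[of _ "if v \<in> e then UNIV else {}"]) auto
    show "prob {\<omega> \<in> space M. \<tau> e \<omega> \<in> B \<and> v \<in> e} = 1 * measure lborel ({0<..<1} \<inter> B)"
      if "e \<in> E" "v \<in> e" "B \<in> sets borel"
      using uniform[of e B] that by simp
  qed (use assms uniform in auto)
qed

lemma annih_random_flip_graph:
  assumes "prob_space M" "simple_graph V E" "countable V" "bounded_degree V E"
    and "iid_clocks_dirs M E \<tau> \<delta>"
  shows "random_flip_graph M V E \<tau> (\<lambda>\<omega> e v. \<delta> e \<omega> = v)
           (\<lambda>e. {(\<lambda>\<omega>. (\<tau> e \<omega>, \<delta> e \<omega>)) -` A \<inter> space M | A. A \<in> sets (borel \<Otimes>\<^sub>M count_space e)}) (1 / 2)"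
proof -
  interpret prob_space M by fact
  let ?N = "\<lambda>e. (borel :: real measure) \<Otimes>\<^sub>M count_space e" and ?Y = "\<lambda>e \<omega>. (\<tau> e \<omega>, \<delta> e \<omega>)"
  let ?U = "uniform_measure lborel {0<..<1::real}"
  have indep: "indep_vars ?N ?Y E"
    and law: "\<And>e. e \<in> E \<Longrightarrow> distr M (?N e) (?Y e) = ?U \<Otimes>\<^sub>M uniform_count_measure e"
    using assms(5) by (auto simp: iid_clocks_dirs_def)
  have meas: "?Y e \<in> measurable M (?N e)" if "e \<in> E" for e
    using indep that by (auto simp: indep_vars_def2)
  have dir: "\<delta> e \<omega> \<in> e" if "e \<in> E" "\<omega> \<in> space M" for e \<omega>
    using measurable_space[OF meas[OF that(1)] that(2)] by (simp add: space_pair_measure)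
  have card: "card e = 2" if "e \<in> E" for e using assms(2) that by (auto simp: simple_graph_def)
  have prob: "prob {\<omega> \<in> space M. \<tau> e \<omega> \<in> B \<and> \<delta> e \<omega> \<in> D} =
      measure lborel ({0<..<1} \<inter> B) * (card D / 2)"
    if "e \<in> E" "B \<in> sets borel" "D \<subseteq> e" for e B D
  proof -
    have fin: "finite e" using card[OF that(1)] by (intro card_ge_0_finite) simp
    interpret C: prob_space "uniform_count_measure e"
      using fin card[OF that(1)] by (intro prob_space_uniform_count_measure) auto
    have "prob {\<omega> \<in> space M. \<tau> e \<omega> \<in> B \<and> \<delta> e \<omega> \<in> D} = measure (distr M (?N e) (?Y e)) (B \<times> D)"
      using meas[OF that(1)] that(2,3)
      by (subst measure_distr) (auto intro!: arg_cong[of _ _ prob])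
    also have "\<dots> = measure ?U B * measure (uniform_count_measure e) D"
      unfolding law[OF that(1)] using that(2,3)
      by (simp add: measure_def C.emeasure_pair_measure_Times sets_uniform_count_measure enn2real_mult)
    also have "\<dots> = measure lborel ({0<..<1} \<inter> B) * (card D / 2)"
      using measure_uniform_unit[OF that(2)] measure_uniform_count_measure[OF fin that(3)]
        card[OF that(1)] by simp
    finally show ?thesis .
  qed
  show ?thesis
  proof
    fix e v and B :: "real set"
    show "indep_sets (\<lambda>e. {?Y e -` A \<inter> space M | A. A \<in> sets (?N e)}) E"
      using indep unfolding indep_vars_def2 by (rule conjunct2)
    show "Int_stable {?Y e -` A \<inter> space M | A. A \<in> sets (?N e)}" by (rule Int_stable_vimages)
    show "{\<omega> \<in> space M. \<tau> e \<omega> \<in> B} \<in> {?Y e -` A \<inter> space M | A. A \<in> sets (?N e)}"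
      if "e \<in> E" "B \<in> sets borel"
    proof (intro CollectI exI conjI)
      show "B \<times> e \<in> sets (?N e)" using that(2) by (intro pair_measureI) simp_all
      show "{\<omega> \<in> space M. \<tau> e \<omega> \<in> B} = ?Y e -` (B \<times> e) \<inter> space M"
        using dir[OF that(1)] by fastforce
    qed
    show "{\<omega> \<in> space M. \<delta> e \<omega> = v} \<in> {?Y e -` A \<inter> space M | A. A \<in> sets (?N e)}" if "e \<in> E"
    proof (intro CollectI exI conjI)
      \<comment> \<open>For \<open>v \<notin> e\<close> the singleton of \<open>v\<close> is not measurable in \<open>count_space e\<close>.\<close>
      show "UNIV \<times> ({v} \<inter> e) \<in> sets (?N e)" by (intro pair_measureI) simp_all
      show "{\<omega> \<in> space M. \<delta> e \<omega> = v} = ?Y e -` (UNIV \<times> ({v} \<inter> e)) \<inter> space M"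
        using dir[OF that] by fastforce
    qed
    show "v \<in> e" if "\<omega> \<in> space M" "e \<in> E" "\<delta> e \<omega> = v" for \<omega>
      using dir that by blast
    show "prob {\<omega> \<in> space M. \<tau> e \<omega> \<in> B} = measure lborel ({0<..<1} \<inter> B)"
      if "e \<in> E" "B \<in> sets borel"
    proof -
      have "{\<omega> \<in> space M. \<tau> e \<omega> \<in> B} = {\<omega> \<in> space M. \<tau> e \<omega> \<in> B \<and> \<delta> e \<omega> \<in> e}"
        using dir[OF that(1)] by auto
      then show ?thesis using prob[OF that order_refl] card[OF that(1)] by simp
    qed
    show "prob {\<omega> \<in> space M. \<tau> e \<omega> \<in> B \<and> \<delta> e \<omega> = v} = 1 / 2 * measure lborel ({0<..<1} \<inter> B)"
      if "e \<in> E" "v \<in> e" "B \<in> sets borel"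
      using prob[of e B "{v}"] that by simp
  qed (use assms in auto)
qed

theorem proposition3:
  fixes M :: "'w measure"
    and V W :: "'a set"
    and E :: "'a set set"
    and \<tau> :: "'a set \<Rightarrow> 'w \<Rightarrow> real"
    and \<delta> :: "'a set \<Rightarrow> 'w \<Rightarrow> 'a"
    and t :: real
  assumes "prob_space M"
    and "simple_graph V E"
    and "countable V"
    and "connected_graph V E"
    and "bounded_degree V E"
    and "\<exists>e\<in>E. \<exists>f\<in>E. e \<noteq> f"
    and "finite W"
    and "W \<subseteq> V"
    and "\<forall>v\<in>W. vertex_degree E v = 1"
    and "0 \<le> t"
    and "t < 1"
  shows "(iid_clocks M E \<tau> \<longrightarrow>
      ((\<lambda>s. \<P>(\<omega> in M. \<forall>v\<in>W. dimer E (\<lambda>e. \<tau> e \<omega>) V s v = 0)) has_real_derivative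
        - (\<Sum>v\<in>W. \<P>(\<omega> in M. \<forall>w\<in>(W \<union> nbhd 1 v V E) - {v}.
              dimer E (\<lambda>e. \<tau> e \<omega>) (V - {v}) t w = 0)))
        (at t within {0..<1})) \<and>
    (iid_clocks_dirs M E \<tau> \<delta> \<longrightarrow>
      ((\<lambda>s. \<P>(\<omega> in M. \<forall>v\<in>W. annih E (\<lambda>e. \<tau> e \<omega>) (\<lambda>e. \<delta> e \<omega>) V s v = 1)) has_real_derivative
        - (1 / 2) * (\<Sum>v\<in>W. \<P>(\<omega> in M. \<forall>w\<in>(W \<union> nbhd 1 v V E) - {v}.
              annih E (\<lambda>e. \<tau> e \<omega>) (\<lambda>e. \<delta> e \<omega>) (V - {v}) t w = 1)))
        (at t within {0..<1}))"
proof (intro conjI impI)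
  have leaves: "random_flip_leaves_axioms V E W a b" if "a \<noteq> b" for a b
    using assms(4,6-9) that by unfold_locales
  assume "iid_clocks M E \<tau>"
  then interpret random_flip_leaves M V E \<tau> "\<lambda>\<omega> e v. v \<in> e"
      "\<lambda>e. {\<tau> e -` A \<inter> space M | A. A \<in> sets borel}" 1 W 0 1
    using assms by (intro random_flip_leaves.intro dimer_random_flip_graph leaves) auto
  show "((\<lambda>s. \<P>(\<omega> in M. \<forall>v\<in>W. dimer E (\<lambda>e. \<tau> e \<omega>) V s v = 0)) has_real_derivative
        - (\<Sum>v\<in>W. \<P>(\<omega> in M. \<forall>w\<in>(W \<union> nbhd 1 v V E) - {v}.
              dimer E (\<lambda>e. \<tau> e \<omega>) (V - {v}) t w = 0)))
        (at t within {0..<1})"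
    using leaf_prob_derivative[OF assms(10,11)]
    unfolding leaf_prob_def near_prob_def near_def dimer_eq_flip_process by simp
next
  have leaves: "random_flip_leaves_axioms V E W a b" if "a \<noteq> b" for a b
    using assms(4,6-9) that by unfold_locales
  assume "iid_clocks_dirs M E \<tau> \<delta>"
  then interpret random_flip_leaves M V E \<tau> "\<lambda>\<omega> e v. \<delta> e \<omega> = v"
      "\<lambda>e. {(\<lambda>\<omega>. (\<tau> e \<omega>, \<delta> e \<omega>)) -` A \<inter> space M | A. A \<in> sets (borel \<Otimes>\<^sub>M count_space e)}" "1 / 2" W 1 0
    using assms by (intro random_flip_leaves.intro annih_random_flip_graph leaves) auto
  show "((\<lambda>s. \<P>(\<omega> in M. \<forall>v\<in>W. annih E (\<lambda>e. \<tau> e \<omega>) (\<lambda>e. \<delta> e \<omega>) V s v = 1)) has_real_derivative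
        - (1 / 2) * (\<Sum>v\<in>W. \<P>(\<omega> in M. \<forall>w\<in>(W \<union> nbhd 1 v V E) - {v}.
              annih E (\<lambda>e. \<tau> e \<omega>) (\<lambda>e. \<delta> e \<omega>) (V - {v}) t w = 1)))
        (at t within {0..<1})"
    using leaf_prob_derivative[OF assms(10,11)]
    unfolding leaf_prob_def[abs_def] near_prob_def near_def annih_eq_flip_process by simp
qed

end
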